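(* Let $G$ be a countable directed graph which has no sinks or has no sources. If $\mathcal{A}$ is any Banach algebra and $\phi:\mathcal{A}\to\mathcal{T}_+(G)$ is a surjective algebra homomorphism, then $\phi$ is (automatically) norm-continuous.
   Context: A countable directed graph $G$ has countable vertex set $\mathcal{V}(G)$, countable edge set $\mathcal{E}(G)$, and range and source maps $r,s$. A vertex is a sink if it is the source of no edge and a source if it is the range of no edge. The free semigroupoid $\mathbb{F}^+(G)$ consists of vertices (paths of length $0$) and finite paths $w=e_k\cdots e_1$ with $s(e_i)=r(e_{i-1})$, $s(w)=s(e_1)$, $r(w)=r(e_k)$. On $\ell^2(\mathbb{F}^+(G))$ with orthonormal basis $\{\xi_w\}$, $L_e\xi_w=\xi_{ew}$ if $s(e)=r(w)$ and $0$ otherwise, and $P_v$ is the projection onto $\overline{\operatorname{span}}\{\xi_w:r(w)=v\}$. The tensor algebra $\mathcal{T}_+(G)$ is the norm-closed operator algebra generated by all $L_e$ and $P_v$. *)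

theory Defs
  imports "HOL-Analysis.Analysis"
begin

text \<open>A directed graph is given by a vertex set V, an edge set E and range/source maps r, s.
  Paths of the free semigroupoid are encoded as pairs (v, es): (v, []) is the vertex v (a path
  of length 0); (r e_k, [e_k, ..., e_1]) is the path w = e_k ... e_1.  In both cases the first
  component is the range r(w).\<close>

definition digraph :: "'v set \<Rightarrow> 'e set \<Rightarrow> ('e \<Rightarrow> 'v) \<Rightarrow> ('e \<Rightarrow> 'v) \<Rightarrow> bool" where
  "digraph V E r s \<longleftrightarrow> (\<forall>e\<in>E. r e \<in> V \<and> s e \<in> V)"

definition no_sinks :: "'v set \<Rightarrow> 'e set \<Rightarrow> ('e \<Rightarrow> 'v) \<Rightarrow> bool" where
  "no_sinks V E s \<longleftrightarrow> (\<forall>v\<in>V. \<exists>e\<in>E. s e = v)"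

definition no_sources :: "'v set \<Rightarrow> 'e set \<Rightarrow> ('e \<Rightarrow> 'v) \<Rightarrow> bool" where
  "no_sources V E r \<longleftrightarrow> (\<forall>v\<in>V. \<exists>e\<in>E. r e = v)"

definition fs_paths :: "'v set \<Rightarrow> 'e set \<Rightarrow> ('e \<Rightarrow> 'v) \<Rightarrow> ('e \<Rightarrow> 'v) \<Rightarrow> ('v \<times> 'e list) set" where
  "fs_paths V E r s =
     {(v, []) | v. v \<in> V} \<union>
     {(r (hd es), es) | es. es \<noteq> [] \<and> set es \<subseteq> E \<and>
        (\<forall>i. Suc i < length es \<longrightarrow> s (es ! i) = r (es ! Suc i))}"

definition ell2 :: "'p set \<Rightarrow> ('p \<Rightarrow> complex) set" where
  "ell2 X = {f. (\<forall>w. w \<notin> X \<longrightarrow> f w = 0) \<and> (\<lambda>w. (cmod (f w))\<^sup>2) summable_on UNIV}"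

definition l2norm :: "('p \<Rightarrow> complex) \<Rightarrow> real" where
  "l2norm f = sqrt (infsum (\<lambda>w. (cmod (f w))\<^sup>2) UNIV)"

type_synonym 'p op = "('p \<Rightarrow> complex) \<Rightarrow> ('p \<Rightarrow> complex)"

text \<open>Operators are represented as maps on all functions which vanish outside l^2(X).\<close>

definition bounded_op :: "'p set \<Rightarrow> 'p op \<Rightarrow> bool" where
  "bounded_op X T \<longleftrightarrow>
     (\<forall>f. f \<notin> ell2 X \<longrightarrow> T f = (\<lambda>_. 0)) \<and>
     (\<forall>f\<in>ell2 X. T f \<in> ell2 X) \<and>
     (\<forall>f\<in>ell2 X. \<forall>g\<in>ell2 X. T (\<lambda>w. f w + g w) = (\<lambda>w. T f w + T g w)) \<and>
     (\<forall>f\<in>ell2 X. \<forall>c. T (\<lambda>w. c * f w) = (\<lambda>w. c * T f w)) \<and>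
     (\<exists>K. \<forall>f\<in>ell2 X. l2norm (T f) \<le> K * l2norm f)"

definition opnorm :: "'p set \<Rightarrow> 'p op \<Rightarrow> real" where
  "opnorm X T = Sup {l2norm (T f) | f. f \<in> ell2 X \<and> l2norm f \<le> 1}"

definition op_add :: "'p op \<Rightarrow> 'p op \<Rightarrow> 'p op" where
  "op_add T S = (\<lambda>f w. T f w + S f w)"

definition op_diff :: "'p op \<Rightarrow> 'p op \<Rightarrow> 'p op" where
  "op_diff T S = (\<lambda>f w. T f w - S f w)"

definition op_scale :: "complex \<Rightarrow> 'p op \<Rightarrow> 'p op" where
  "op_scale c T = (\<lambda>f w. c * T f w)"

definition op_comp :: "'p op \<Rightarrow> 'p op \<Rightarrow> 'p op" where
  "op_comp T S = (\<lambda>f. T (S f))"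

text \<open>Vertex projection P_v and edge operator L_e on l^2 of the free semigroupoid:
  (L_e f)(e w) = f(w), i.e. L_e xi_w = xi_{ew} if s(e) = r(w) and 0 otherwise.\<close>

definition P_op :: "'v set \<Rightarrow> 'e set \<Rightarrow> ('e \<Rightarrow> 'v) \<Rightarrow> ('e \<Rightarrow> 'v) \<Rightarrow> 'v \<Rightarrow> ('v \<times> 'e list) op" where
  "P_op V E r s v = (\<lambda>f. if f \<in> ell2 (fs_paths V E r s)
      then (\<lambda>w. if w \<in> fs_paths V E r s \<and> fst w = v then f w else 0) else (\<lambda>_. 0))"

definition L_op :: "'v set \<Rightarrow> 'e set \<Rightarrow> ('e \<Rightarrow> 'v) \<Rightarrow> ('e \<Rightarrow> 'v) \<Rightarrow> 'e \<Rightarrow> ('v \<times> 'e list) op" where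
  "L_op V E r s e = (\<lambda>f. if f \<in> ell2 (fs_paths V E r s)
      then (\<lambda>(u, es). case es of [] \<Rightarrow> 0
              | e' # es' \<Rightarrow> if e' = e \<and> (u, es) \<in> fs_paths V E r s
                           then f (if es' = [] then s e else r (hd es'), es') else 0)
      else (\<lambda>_. 0))"

inductive_set gen_alg :: "'v set \<Rightarrow> 'e set \<Rightarrow> ('e \<Rightarrow> 'v) \<Rightarrow> ('e \<Rightarrow> 'v) \<Rightarrow> ('v \<times> 'e list) op set"
  for V E r s where
  gen_P: "v \<in> V \<Longrightarrow> P_op V E r s v \<in> gen_alg V E r s"
| gen_L: "e \<in> E \<Longrightarrow> L_op V E r s e \<in> gen_alg V E r s"
| gen_add: "T \<in> gen_alg V E r s \<Longrightarrow> S \<in> gen_alg V E r s \<Longrightarrow> op_add T S \<in> gen_alg V E r s"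
| gen_comp: "T \<in> gen_alg V E r s \<Longrightarrow> S \<in> gen_alg V E r s \<Longrightarrow> op_comp T S \<in> gen_alg V E r s"
| gen_scale: "T \<in> gen_alg V E r s \<Longrightarrow> op_scale c T \<in> gen_alg V E r s"

definition tensor_alg :: "'v set \<Rightarrow> 'e set \<Rightarrow> ('e \<Rightarrow> 'v) \<Rightarrow> ('e \<Rightarrow> 'v) \<Rightarrow> ('v \<times> 'e list) op set" where
  "tensor_alg V E r s = {T. bounded_op (fs_paths V E r s) T \<and>
     (\<forall>\<epsilon>>0. \<exists>S\<in>gen_alg V E r s. opnorm (fs_paths V E r s) (op_diff T S) < \<epsilon>)}"

definition complex_banach_algebra :: "(complex \<Rightarrow> 'a::{banach, real_normed_algebra} \<Rightarrow> 'a) \<Rightarrow> bool" where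
  "complex_banach_algebra smul \<longleftrightarrow>
     (\<forall>t x. smul (complex_of_real t) x = t *\<^sub>R x) \<and>
     (\<forall>a b x. smul (a * b) x = smul a (smul b x)) \<and>
     (\<forall>a b x. smul (a + b) x = smul a x + smul b x) \<and>
     (\<forall>a x y. smul a (x + y) = smul a x + smul a y) \<and>
     (\<forall>a x y. smul a (x * y) = smul a x * y \<and> smul a (x * y) = x * smul a y) \<and>
     (\<forall>a x. norm (smul a x) = cmod a * norm x)"

definition op_alg_hom :: "(complex \<Rightarrow> 'a::{banach, real_normed_algebra} \<Rightarrow> 'a) \<Rightarrow> ('a \<Rightarrow> 'p op) \<Rightarrow> bool" where
  "op_alg_hom smul \<phi> \<longleftrightarrow>
     (\<forall>x y. \<phi> (x + y) = op_add (\<phi> x) (\<phi> y)) \<and>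
     (\<forall>x y. \<phi> (x * y) = op_comp (\<phi> x) (\<phi> y)) \<and>
     (\<forall>c x. \<phi> (smul c x) = op_scale c (\<phi> x))"

end

theory Submission
  imports Defs
begin

text \<open>
  Choose weights \<open>t e > 0\<close> with \<open>\<Sum> (t e)\<^sup>2 < \<infinity>\<close>. Then \<open>W = \<Sum> t e L\<^sub>e\<close> lies in the tensor algebra, so
  \<open>W = \<phi> a\<close> for some \<open>a\<close>, and \<open>W\<^sup>k\<close> raises path lengths by \<open>k\<close>. Let \<open>T = \<phi> x\<close>.

  If there are no sinks, every path \<open>w\<close> extends to a path \<open>p w\<close> with \<open>p\<close> of any length \<open>k\<close>. The
  coefficient of \<open>W\<^sup>k T f\<close> at \<open>p w\<close> is a nonzero multiple of that of \<open>T f\<close> at \<open>w\<close>, whereas the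
  coefficient of \<open>W\<^sup>m T f\<close> at \<open>p w\<close> is \<open>0\<close> once \<open>m\<close> exceeds the length of \<open>p w\<close>. A gliding hump
  argument (in the spirit of Sinclair's stability lemma) with left multiplication by a power of \<open>a\<close>
  then shows that \<open>x \<mapsto> (\<phi> x f) w\<close> is bounded. If there are no sources, paths are extended on the
  right, and right multiplication by powers of \<open>a\<close> is used instead; this needs that the tensor algebra
  commutes with right translations of paths. Once all coefficients are bounded, the uniform
  boundedness principle gives the boundedness of \<open>\<phi>\<close>.
\<close>

section \<open>Seminorms on Banach spaces\<close>

text \<open>Nonnegativity is implied: 0 = \<open>q 0\<close> \<le> \<open>q x + q (- x)\<close> =
  \<open>2 * q x\<close>.\<close>

definition seminorm :: "('a::real_vector \<Rightarrow> real) \<Rightarrow> bool" where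
  "seminorm q \<longleftrightarrow> (\<forall>x y. q (x + y) \<le> q x + q y) \<and> (\<forall>t x. q (t *\<^sub>R x) = \<bar>t\<bar> * q x)"

lemma seminorm_triangle: "seminorm q \<Longrightarrow> q (x + y) \<le> q x + q y"
  and seminorm_scaleR: "seminorm q \<Longrightarrow> q (t *\<^sub>R x) = \<bar>t\<bar> * q x"
  by (auto simp: seminorm_def)

lemma seminorm_minus: "seminorm q \<Longrightarrow> q (- x) = q x"
  using seminorm_scaleR[of q "-1" x] by simp

lemma seminorm_diff_le: "seminorm q \<Longrightarrow> q x - q y \<le> q (x - y)"
  using seminorm_triangle[of q "x - y" y] by simp

text \<open>A vector on which \<open>q\<close> is large relative to the norm can be rescaled to norm
  \<open>d\<close>. This supplies the humps of the next argument: small in norm, tall for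
  \<open>q\<close>.\<close>

lemma seminorm_unbounded_witness:
  assumes q: "seminorm q" and unb: "\<not> (\<exists>K. \<forall>x. q x \<le> K * norm x)" and d: "d > 0"
  shows "\<exists>x. norm x \<le> d \<and> c \<le> q x"
proof -
  obtain x where x: "\<bar>c\<bar> / d * norm x < q x"
    using unb by (meson not_le)
  have "x \<noteq> 0"
    using x seminorm_scaleR[OF q, of 0 0] by auto
  let ?y = "(d / norm x) *\<^sub>R x"
  have "norm ?y \<le> d"
    using d \<open>x \<noteq> 0\<close> by simp
  moreover have "q ?y = d / norm x * q x"
    using d by (simp add: seminorm_scaleR[OF q])
  moreover have "\<bar>c\<bar> < d / norm x * q x"
    using x d \<open>x \<noteq> 0\<close> by (simp add: field_simps)
  ultimately show ?thesis
    by (metis abs_ge_self less_le_not_le order_trans)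
qed

lemma bounded_linear_funpow:
  fixes M :: "'a::real_normed_vector \<Rightarrow> 'a"
  assumes "bounded_linear M"
  shows "bounded_linear (M ^^ n)"
proof (induction n)
  case 0
  show ?case by (simp add: id_def)
next
  case (Suc n)
  show ?case using bounded_linear_compose[OF assms Suc] by (simp add: o_def)
qed

lemma norm_funpow_le:
  fixes M :: "'a::real_normed_vector \<Rightarrow> 'a"
  assumes "\<And>x. norm (M x) \<le> norm x"
  shows "norm ((M ^^ n) x) \<le> norm x"
  by (induction n) (auto intro: order_trans[OF assms])

text \<open>The seminorms are not assumed continuous. If every \<open>q n \<circ> M ^^ n\<close> were unbounded, one could
  choose small \<open>x\<^sub>n\<close> inductively so that \<open>z = (\<Sum>n. (M ^^ n) x\<^sub>n)\<close> has \<open>q n z \<ge> n\<close>: the tail of the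
  series lies in the range of \<open>M ^^ Suc n\<close>, where \<open>q n\<close> is under control.\<close>

lemma gliding_hump:
  fixes M :: "'a::banach \<Rightarrow> 'a" and q :: "nat \<Rightarrow> 'a \<Rightarrow> real"
  assumes M: "bounded_linear M" and contr: "\<And>x. norm (M x) \<le> norm x"
    and q: "\<And>n. seminorm (q n)"
    and pointwise: "\<And>x. \<exists>C. \<forall>n. q n x \<le> C"
    and bdd: "\<And>n. \<exists>K. \<forall>x. q n ((M ^^ Suc n) x) \<le> K * norm x"
  shows "\<exists>n K. \<forall>x. q n ((M ^^ n) x) \<le> K * norm x"
proof (rule ccontr)
  assume neg: "\<not> ?thesis"
  have lin: "bounded_linear (M ^^ n)" for n
    by (rule bounded_linear_funpow[OF M])
  have contr_n: "norm ((M ^^ n) x) \<le> norm x" for n x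
    by (rule norm_funpow_le[OF contr])
  have "\<exists>K\<ge>0. \<forall>x. q n ((M ^^ Suc n) x) \<le> K * norm x" for n
  proof -
    obtain K where "\<forall>x. q n ((M ^^ Suc n) x) \<le> K * norm x"
      using bdd by blast
    then have "\<forall>x. q n ((M ^^ Suc n) x) \<le> \<bar>K\<bar> * norm x"
      by (meson abs_ge_self mult_right_mono norm_ge_zero order_trans)
    then show ?thesis
      by (meson abs_ge_zero)
  qed
  then obtain K where K0: "\<And>n. 0 \<le> K n"
    and K: "\<And>n x. q n ((M ^^ Suc n) x) \<le> K n * norm x"
    by metis
  have semi: "seminorm (\<lambda>x. q n ((M ^^ n) x))" for n
    using q[of n] linear_simps[OF lin[of n]] by (simp add: seminorm_def)
  \<comment> \<open>The height has three parts: \<open>q n y\<close> will absorb the earlier humps,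
    \<open>K n\<close> the later ones, and \<open>n\<close> is what remains.\<close>
  have "\<exists>x. norm x \<le> (1/2)^n \<and> real n + K n + q n y \<le> q n ((M ^^ n) x)" for n y
    using neg by (intro seminorm_unbounded_witness[OF semi]) auto
  then obtain X where X1: "\<And>n y. norm (X n y) \<le> (1/2)^n"
    and X2: "\<And>n y. real n + K n + q n y \<le> q n ((M ^^ n) (X n y))"
    by metis
  \<comment> \<open>The n-th hump depends on the sum of the earlier ones, so the partial sums are
    defined first and the humps read off from them.\<close>
  define S where "S = rec_nat 0 (\<lambda>n s. s + (M ^^ n) (X n s))"
  have S0: "S 0 = 0" and SSuc: "\<And>n. S (Suc n) = S n + (M ^^ n) (X n (S n))"
    by (simp_all add: S_def)
  define x where "x n = X n (S n)" for n
  have S: "S n = (\<Sum>j<n. (M ^^ j) (x j))" for n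
    by (induction n) (simp_all add: S0 SSuc x_def)
  have geo: "summable (\<lambda>j. (1/2::real)^(j + m))" for m
    by (rule summable_ignore_initial_segment) (simp add: summable_geometric)
  have xn: "norm ((M ^^ i) (x j)) \<le> (1/2)^j" for i j
    using contr_n[of i "x j"] X1[of j "S j"] unfolding x_def by linarith
  \<comment> \<open>The exponent is decoupled from the index of \<open>x\<close>, because the tail
    appears below with \<open>M ^^ Suc n\<close> factored out.\<close>
  have summ: "summable (\<lambda>j. (M ^^ i j) (x (j + m)))" for i m
    by (rule summable_comparison_test[OF _ geo[of m]]) (use xn in auto)
  define z where "z = (\<Sum>j. (M ^^ j) (x j))"
  have "real n \<le> q n z" for n
  proof -
    \<comment> \<open>The humps after stage \<open>n\<close> add up to
      \<open>(M ^^ Suc n) y\<close>. The norm of \<open>y\<close> is at most the sum of (1/2)^j over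
      j > n, which is (1/2)^n.\<close>
    define y where "y = (\<Sum>j. (M ^^ j) (x (j + Suc n)))"
    have "norm y \<le> (\<Sum>j. (1/2::real)^(j + Suc n))"
      unfolding y_def by (rule norm_suminf_le[OF _ geo]) (rule xn)
    also have "\<dots> = (1/2) ^ n"
    proof -
      have "(\<lambda>j. (1/2::real)^j * (1/2)^Suc n) sums (1 / (1 - 1/2) * (1/2)^Suc n)"
        by (intro sums_mult2 geometric_sums) simp
      then show ?thesis
        by (simp add: power_add sums_iff)
    qed
    also have "\<dots> \<le> 1"
      by (simp add: power_le_one)
    finally have y1: "norm y \<le> 1" .
    have "z = (\<Sum>j. (M ^^ (j + Suc n)) (x (j + Suc n))) + S (Suc n)"
      unfolding z_def S by (rule suminf_split_initial_segment) (use summ[of id 0] in simp)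
    also have "(\<lambda>j. (M ^^ (j + Suc n)) (x (j + Suc n))) = (\<lambda>j. (M ^^ Suc n) ((M ^^ j) (x (j + Suc n))))"
      by (metis add.commute comp_apply funpow_add)
    also have "suminf \<dots> = (M ^^ Suc n) y"
      unfolding y_def using bounded_linear.suminf[OF lin[of "Suc n"] summ[of id "Suc n"]]
      by (simp only: id_apply)
    \<comment> \<open>The n-th hump is isolated, so that \<open>q n z\<close> is bounded below by
      its height minus the contributions of earlier and later humps.\<close>
    finally have z: "z = (M ^^ n) (x n) - (- (S n + (M ^^ Suc n) y))"
      by (simp add: SSuc x_def algebra_simps)
    have "q n ((M ^^ n) (x n)) \<le> q n z + q n (S n + (M ^^ Suc n) y)"
      using seminorm_triangle[OF q, of n z "- (S n + (M ^^ Suc n) y)"] z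
      by (simp add: seminorm_minus[OF q] flip: minus_add_distrib)
    moreover have "q n (S n + (M ^^ Suc n) y) \<le> q n (S n) + K n * norm y"
      using seminorm_triangle[OF q, of n "S n" "(M ^^ Suc n) y"] K[of n y] by linarith
    moreover have "K n * norm y \<le> K n"
      using K0[of n] y1 by (simp add: mult_left_le)
    ultimately show ?thesis
      using X2[of n "S n"] unfolding x_def by linarith
  qed
  moreover obtain C where "\<And>n. q n z \<le> C"
    using pointwise by blast
  ultimately show False
    by (meson not_le order_trans reals_Archimedean2)
qed

text \<open>Baire category: each \<open>q i\<close> is Lipschitz by its own bound, so the sets on
  which all \<open>q i\<close> are at most \<open>k\<close> are closed. They cover the space, hence
  one of them contains a ball, and homogeneity turns this into a common bound.\<close>

lemma uniform_boundedness:
  fixes q :: "'i \<Rightarrow> 'a::banach \<Rightarrow> real"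
  assumes q: "\<And>i. i \<in> I \<Longrightarrow> seminorm (q i)"
    and bdd: "\<And>i. i \<in> I \<Longrightarrow> \<exists>K. \<forall>x. q i x \<le> K * norm x"
    and pointwise: "\<And>x. \<exists>C. \<forall>i\<in>I. q i x \<le> C"
  shows "\<exists>K. \<forall>i\<in>I. \<forall>x. q i x \<le> K * norm x"
proof -
  have cont: "continuous_on UNIV (q i)" if i: "i \<in> I" for i
  proof -
    obtain K where K: "\<And>x. q i x \<le> K * norm x"
      using bdd[OF i] by blast
    have "dist (q i x) (q i y) \<le> \<bar>K\<bar> * dist x y" for x y
    proof -
      have "q i (x - y) \<le> \<bar>K\<bar> * norm (x - y)"
        by (meson K abs_ge_self mult_right_mono norm_ge_zero order_trans)
      then show ?thesis
        using seminorm_diff_le[OF q[OF i], of x y] seminorm_diff_le[OF q[OF i], of y x]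
          seminorm_minus[OF q[OF i], of "x - y"]
        by (simp add: dist_norm abs_le_iff)
    qed
    then have "\<bar>K\<bar>-lipschitz_on UNIV (q i)"
      by (intro lipschitz_onI) auto
    then show ?thesis
      by (rule lipschitz_on_continuous_on)
  qed
  define A where "A k = {x. \<forall>i\<in>I. q i x \<le> real k}" for k
  have clo: "closed (A k)" for k
  proof -
    have "A k = (\<Inter>i\<in>I. {x. q i x \<le> real k})"
      by (auto simp: A_def)
    moreover have "closed {x. q i x \<le> real k}" if "i \<in> I" for i
      using cont[OF that] by (intro closed_Collect_le) auto
    ultimately show ?thesis
      by auto
  qed
  have "(\<Union>k. A k) = UNIV"
  proof -
    have "\<exists>k. x \<in> A k" for x
    proof -
      obtain C where "\<forall>i\<in>I. q i x \<le> C"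
        using pointwise by blast
      moreover obtain k where "C \<le> real k"
        using real_arch_simple by blast
      ultimately show ?thesis
        unfolding A_def by (intro exI[of _ k]) force
    qed
    then show ?thesis by auto
  qed
  moreover have "interior (\<Union>(range A)) = {}" if "\<And>k. interior (A k) = {}"
    using Met_TC.metric_Baire_category_alt[of "range A"] that clo
    by (auto simp: complete_UNIV)
  ultimately obtain k where "interior (A k) \<noteq> {}"
    by fastforce
  then obtain x0 d where d: "d > 0" and ball: "cball x0 d \<subseteq> A k"
    by (meson ex_in_conv interior_subset mem_interior_cball)
  have "q i x \<le> (2 * real k / d) * norm x" if i: "i \<in> I" for i x
  proof (cases "x = 0")
    case True
    then show ?thesis using seminorm_scaleR[OF q[OF i], of 0 0] by simp
  next
    case False
    let ?y = "(d / norm x) *\<^sub>R x"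
    \<comment> \<open>Recentring the ball at the origin costs a factor 2, by the triangle inequality
      for \<open>?y = (x0 + ?y) - x0\<close>.\<close>
    have "x0 + ?y \<in> A k" "x0 \<in> A k"
      using ball d False by (auto simp: subset_iff dist_norm)
    then have "q i (x0 + ?y) \<le> k" "q i x0 \<le> k"
      using i by (auto simp: A_def)
    then have "q i ?y \<le> 2 * real k"
      using seminorm_triangle[OF q[OF i], of "x0 + ?y" "- x0"] by (simp add: seminorm_minus[OF q[OF i]])
    then show ?thesis
      using d False by (simp add: seminorm_scaleR[OF q[OF i]] field_simps)
  qed
  then show ?thesis
    by blast
qed

section \<open>Operators on square-summable functions\<close>

lemma ell2_eq_0: "f \<in> ell2 X \<Longrightarrow> w \<notin> X \<Longrightarrow> f w = 0"
  by (simp add: ell2_def)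

text \<open>Both facts are decided by finite partial sums, which reduces estimates in
  \<open>ell2\<close> to those for \<open>L2_set\<close> on finite sets.\<close>

lemma
  assumes zero: "\<And>w. w \<notin> X \<Longrightarrow> f w = 0"
    and bound: "\<And>F. finite F \<Longrightarrow> L2_set (\<lambda>w. cmod (f w)) F \<le> c"
  shows ell2I: "f \<in> ell2 X" and l2norm_le: "l2norm f \<le> c"
proof -
  have "0 \<le> c"
    using bound[of "{}"] by simp
  have le: "(\<Sum>w\<in>F. (cmod (f w))\<^sup>2) \<le> c\<^sup>2" if "finite F" for F
    using bound[OF that] unfolding L2_set_def by (rule sqrt_le_D)
  have summ: "(\<lambda>w. (cmod (f w))\<^sup>2) summable_on UNIV"
    by (rule nonneg_bdd_above_summable_on) (auto intro!: bdd_aboveI2 le)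
  then show "f \<in> ell2 X"
    using zero by (simp add: ell2_def)
  have "infsum (\<lambda>w. (cmod (f w))\<^sup>2) UNIV \<le> c\<^sup>2"
    by (rule infsum_le_finite_sums[OF summ le])
  then show "l2norm f \<le> c"
    using \<open>0 \<le> c\<close> unfolding l2norm_def by (rule real_le_lsqrt[rotated])
qed

lemma L2_set_le_l2norm:
  assumes "f \<in> ell2 X"
  shows "L2_set (\<lambda>w. cmod (f w)) F \<le> l2norm f"
proof (cases "finite F")
  case True
  then show ?thesis
    using assms unfolding L2_set_def l2norm_def ell2_def
    by (intro real_sqrt_le_mono finite_sum_le_infsum) auto
qed (simp add: l2norm_def infsum_nonneg)

lemma l2norm_nonneg: "0 \<le> l2norm f"
  by (simp add: l2norm_def infsum_nonneg)

lemma norm_le_l2norm: "f \<in> ell2 X \<Longrightarrow> cmod (f w) \<le> l2norm f"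
  using L2_set_le_l2norm[of f X "{w}"] by simp

lemma
  assumes f: "f \<in> ell2 X" and g: "g \<in> ell2 X"
  shows ell2_add: "(\<lambda>w. f w + g w) \<in> ell2 X"
    and l2norm_add: "l2norm (\<lambda>w. f w + g w) \<le> l2norm f + l2norm g"
proof -
  have "L2_set (\<lambda>w. cmod (f w + g w)) F \<le> l2norm f + l2norm g" for F
  proof -
    have "L2_set (\<lambda>w. cmod (f w + g w)) F \<le> L2_set (\<lambda>w. cmod (f w) + cmod (g w)) F"
      by (intro L2_set_mono norm_triangle_ineq) auto
    also have "\<dots> \<le> L2_set (\<lambda>w. cmod (f w)) F + L2_set (\<lambda>w. cmod (g w)) F"
      by (rule L2_set_triangle_ineq)
    finally show ?thesis
      using L2_set_le_l2norm[OF f] L2_set_le_l2norm[OF g] by (meson add_mono order_trans)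
  qed
  then show "(\<lambda>w. f w + g w) \<in> ell2 X" "l2norm (\<lambda>w. f w + g w) \<le> l2norm f + l2norm g"
    using f g by (auto intro!: ell2I[where c = "l2norm f + l2norm g"] l2norm_le simp: ell2_eq_0)
qed

lemma
  assumes f: "f \<in> ell2 X"
  shows ell2_scale: "(\<lambda>w. c * f w) \<in> ell2 X"
    and l2norm_scale: "l2norm (\<lambda>w. c * f w) \<le> cmod c * l2norm f"
proof -
  have "L2_set (\<lambda>w. cmod (c * f w)) F \<le> cmod c * l2norm f" for F
    using L2_set_le_l2norm[OF f, of F]
    by (simp add: norm_mult mult_left_mono flip: L2_set_right_distrib)
  then show "(\<lambda>w. c * f w) \<in> ell2 X" "l2norm (\<lambda>w. c * f w) \<le> cmod c * l2norm f"
    using f by (auto intro!: ell2I[where c = "cmod c * l2norm f"] l2norm_le simp: ell2_eq_0)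
qed

lemma ell2_diff:
  assumes f: "f \<in> ell2 X" and g: "g \<in> ell2 X"
  shows "(\<lambda>w. f w - g w) \<in> ell2 X"
  using ell2_add[OF f ell2_scale[OF g, of "-1"]] by simp

lemma ell2_zero: "(\<lambda>_. 0) \<in> ell2 X"
  by (simp add: ell2_def)

lemma l2norm_zero [simp]: "l2norm (\<lambda>_. 0) = 0"
  by (simp add: l2norm_def)

lemma
  assumes f: "f \<in> ell2 X"
  shows ell2_restrict: "(\<lambda>w. if w \<in> F then f w else 0) \<in> ell2 X"
    and l2norm_restrict: "l2norm (\<lambda>w. if w \<in> F then f w else 0) \<le> l2norm f"
proof -
  have "L2_set (\<lambda>w. cmod (if w \<in> F then f w else 0)) G \<le> l2norm f" for G
    by (rule order_trans[OF L2_set_mono L2_set_le_l2norm[OF f, of G]]) auto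
  then show "(\<lambda>w. if w \<in> F then f w else 0) \<in> ell2 X"
    "l2norm (\<lambda>w. if w \<in> F then f w else 0) \<le> l2norm f"
    using f by (auto intro!: ell2I[where c = "l2norm f"] l2norm_le simp: ell2_eq_0)
qed

text \<open>These are the basis vectors \<xi>_u.\<close>

definition ket :: "'p \<Rightarrow> 'p \<Rightarrow> complex" where
  "ket u = (\<lambda>w. if w = u then 1 else 0)"

lemma L2_set_ket: "finite F \<Longrightarrow> L2_set (\<lambda>w. cmod (ket u w)) F \<le> 1"
  using sum.delta[of F u "\<lambda>_. 1::real"]
  by (simp add: L2_set_def ket_def if_distrib[of cmod] if_distrib[of "\<lambda>x. x\<^sup>2"] cong: if_cong)

lemma ell2_ket: "u \<in> X \<Longrightarrow> ket u \<in> ell2 X"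
  by (rule ell2I[OF _ L2_set_ket]) (auto simp: ket_def)

lemma l2norm_ket: "l2norm (ket u) \<le> 1"
  by (rule l2norm_le[OF _ L2_set_ket, of UNIV]) auto

text \<open>The tail of a convergent sum of squares is small. This serves to pass from finitely
  supported vectors to all of \<open>ell2\<close>.\<close>

lemma ell2_finite_approx:
  assumes f: "f \<in> ell2 X" and e: "e > 0"
  shows "\<exists>F. finite F \<and> l2norm (\<lambda>w. if w \<in> F then 0 else f w) \<le> e"
proof -
  let ?q = "\<lambda>w. (cmod (f w))\<^sup>2"
  have summ: "?q summable_on UNIV"
    using f by (simp add: ell2_def)
  obtain F where F: "finite F" "dist (sum ?q F) (infsum ?q UNIV) \<le> e\<^sup>2"
    using infsum_finite_approximation[OF summ, of "e\<^sup>2"] e by auto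
  have "L2_set (\<lambda>w. cmod (if w \<in> F then 0 else f w)) G \<le> e" if "finite G" for G
  proof -
    have "(\<Sum>w\<in>G. (cmod (if w \<in> F then 0 else f w))\<^sup>2) = sum ?q (G - F)"
      using that by (auto intro!: sum.mono_neutral_cong_right)
    also have "\<dots> = sum ?q (G \<union> F) - sum ?q F"
      using that F(1) sum.union_disjoint[of "G - F" F ?q] by (auto simp: Int_commute)
    also have "sum ?q (G \<union> F) \<le> infsum ?q UNIV"
      using that F(1) by (intro finite_sum_le_infsum summ) auto
    also have "infsum ?q UNIV - sum ?q F \<le> e\<^sup>2"
      using F(2) by (simp add: dist_real_def)
    finally show ?thesis
      using e unfolding L2_set_def by (intro real_le_lsqrt) auto
  qed
  then show ?thesis
    using F(1) f by (auto intro!: l2norm_le[of X] exI[of _ F] simp: ell2_eq_0)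
qed

section \<open>Bounded operators and the operator norm\<close>

lemma bounded_op_ell2: "bounded_op X T \<Longrightarrow> f \<in> ell2 X \<Longrightarrow> T f \<in> ell2 X"
  and bounded_op_add: "bounded_op X T \<Longrightarrow> f \<in> ell2 X \<Longrightarrow> g \<in> ell2 X \<Longrightarrow>
    T (\<lambda>w. f w + g w) = (\<lambda>w. T f w + T g w)"
  and bounded_op_scale: "bounded_op X T \<Longrightarrow> f \<in> ell2 X \<Longrightarrow> T (\<lambda>w. c * f w) = (\<lambda>w. c * T f w)"
  by (auto simp: bounded_op_def)

lemma bounded_op_outside: "bounded_op X T \<Longrightarrow> f \<notin> ell2 X \<Longrightarrow> T f = (\<lambda>_. 0)"
  by (simp add: bounded_op_def)

lemma bounded_op_zero: "bounded_op X T \<Longrightarrow> T (\<lambda>_. 0) = (\<lambda>_. 0)"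
  using bounded_op_scale[OF _ ell2_zero, of X T 0] by simp

lemma bounded_op_diff:
  assumes T: "bounded_op X T" and f: "f \<in> ell2 X" and g: "g \<in> ell2 X"
  shows "T (\<lambda>w. f w - g w) = (\<lambda>w. T f w - T g w)"
  using bounded_op_add[OF T f ell2_scale[OF g, of "-1"]] bounded_op_scale[OF T g, of "-1"] by simp

lemma opnorm_bound:
  assumes T: "bounded_op X T" and f: "f \<in> ell2 X"
  shows "l2norm (T f) \<le> opnorm X T * l2norm f"
proof (cases "l2norm f = 0")
  case True
  then have "f = (\<lambda>_. 0)"
    using norm_le_l2norm[OF f] by (intro ext) simp
  then show ?thesis
    by (simp add: bounded_op_zero[OF T])
next
  case False
  then have pos: "l2norm f > 0"
    using l2norm_nonneg[of f] by linarith
  let ?S = "{l2norm (T f) | f. f \<in> ell2 X \<and> l2norm f \<le> 1}"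
  obtain K where K: "\<And>f. f \<in> ell2 X \<Longrightarrow> l2norm (T f) \<le> K * l2norm f"
    using T unfolding bounded_op_def by blast
  \<comment> \<open>A real supremum dominates the elements only if the set is bounded above, so this
    precedes any use of \<open>opnorm\<close>.\<close>
  have bdd: "bdd_above ?S"
  proof (rule bdd_aboveI)
    fix y assume "y \<in> ?S"
    then obtain g where g: "g \<in> ell2 X" "l2norm g \<le> 1" "y = l2norm (T g)"
      by auto
    have "K * l2norm g \<le> \<bar>K\<bar> * 1"
      by (intro mult_mono g(2) l2norm_nonneg) auto
    then show "y \<le> \<bar>K\<bar>"
      using K[OF g(1)] g(3) by simp
  qed
  let ?c = "complex_of_real (inverse (l2norm f))"
  let ?g = "\<lambda>w. ?c * f w"
  have g: "?g \<in> ell2 X"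
    by (rule ell2_scale[OF f])
  have "l2norm ?g \<le> 1"
    using l2norm_scale[OF f, of ?c] pos by (simp add: norm_inverse)
  then have "l2norm (T ?g) \<le> opnorm X T"
    unfolding opnorm_def using g bdd by (intro cSup_upper) auto
  then have "l2norm f * l2norm (T ?g) \<le> l2norm f * opnorm X T"
    using pos by (intro mult_left_mono) auto
  moreover have "(\<lambda>w. complex_of_real (l2norm f) * ?g w) = f"
    using pos by (intro ext) simp
  then have "T f = (\<lambda>w. complex_of_real (l2norm f) * T ?g w)"
    using bounded_op_scale[OF T g, of "complex_of_real (l2norm f)"] by simp
  then have "l2norm (T f) \<le> l2norm f * l2norm (T ?g)"
    using l2norm_scale[OF bounded_op_ell2[OF T g], of "complex_of_real (l2norm f)"] pos by simp
  ultimately show ?thesis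
    by (simp add: mult.commute)
qed

lemma opnorm_le:
  assumes "\<And>f. f \<in> ell2 X \<Longrightarrow> l2norm f \<le> 1 \<Longrightarrow> l2norm (T f) \<le> K"
  shows "opnorm X T \<le> K"
  unfolding opnorm_def
proof (rule cSup_least)
  show "{l2norm (T f) |f. f \<in> ell2 X \<and> l2norm f \<le> 1} \<noteq> {}"
    using ell2_zero[of X] by (auto intro!: exI[of _ "\<lambda>_. 0"])
qed (use assms in auto)

lemma norm_bounded_op_le:
  assumes "bounded_op X T" and "f \<in> ell2 X"
  shows "cmod (T f w) \<le> opnorm X T * l2norm f"
  using norm_le_l2norm[OF bounded_op_ell2[OF assms]] opnorm_bound[OF assms] by (rule order_trans)

lemma bounded_opI:
  assumes "\<And>f. f \<notin> ell2 X \<Longrightarrow> T f = (\<lambda>_. 0)"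
    and "\<And>f. f \<in> ell2 X \<Longrightarrow> T f \<in> ell2 X"
    and "\<And>f g. f \<in> ell2 X \<Longrightarrow> g \<in> ell2 X \<Longrightarrow> T (\<lambda>w. f w + g w) = (\<lambda>w. T f w + T g w)"
    and "\<And>f c. f \<in> ell2 X \<Longrightarrow> T (\<lambda>w. c * f w) = (\<lambda>w. c * T f w)"
    and "\<And>f. f \<in> ell2 X \<Longrightarrow> l2norm (T f) \<le> K * l2norm f"
  shows "bounded_op X T"
  using assms unfolding bounded_op_def by blast

lemma bounded_op_op_add:
  assumes T: "bounded_op X T" and S: "bounded_op X S"
  shows "bounded_op X (op_add T S)"
proof (rule bounded_opI)
  show "l2norm (op_add T S f) \<le> (opnorm X T + opnorm X S) * l2norm f" if "f \<in> ell2 X" for f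
    using l2norm_add[OF bounded_op_ell2[OF T that] bounded_op_ell2[OF S that]]
      opnorm_bound[OF T that] opnorm_bound[OF S that]
    by (simp add: op_add_def distrib_right)
qed (simp_all add: op_add_def bounded_op_outside[OF T] bounded_op_outside[OF S] bounded_op_add[OF T]
    bounded_op_add[OF S] bounded_op_scale[OF T] bounded_op_scale[OF S] algebra_simps
    ell2_add bounded_op_ell2[OF T] bounded_op_ell2[OF S])

lemma bounded_op_op_scale:
  assumes T: "bounded_op X T"
  shows "bounded_op X (op_scale c T)"
proof (rule bounded_opI)
  show "l2norm (op_scale c T f) \<le> (cmod c * opnorm X T) * l2norm f" if "f \<in> ell2 X" for f
  proof -
    have "l2norm (op_scale c T f) \<le> cmod c * l2norm (T f)"
      unfolding op_scale_def by (rule l2norm_scale[OF bounded_op_ell2[OF T that]])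
    also have "\<dots> \<le> cmod c * (opnorm X T * l2norm f)"
      by (intro mult_left_mono opnorm_bound[OF T that]) auto
    finally show ?thesis by (simp add: mult.assoc)
  qed
qed (simp_all add: op_scale_def bounded_op_outside[OF T] bounded_op_add[OF T] bounded_op_scale[OF T]
    algebra_simps ell2_scale bounded_op_ell2[OF T])

lemma op_diff_eq: "op_diff T S = op_add T (op_scale (-1) S)"
  by (simp add: op_diff_def op_add_def op_scale_def)

lemma bounded_op_op_diff: "bounded_op X T \<Longrightarrow> bounded_op X S \<Longrightarrow> bounded_op X (op_diff T S)"
  by (simp add: op_diff_eq bounded_op_op_add bounded_op_op_scale)

lemma bounded_op_op_comp:
  assumes T: "bounded_op X T" and S: "bounded_op X S"
  shows "bounded_op X (op_comp T S)"
proof (rule bounded_opI)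
  show "l2norm (op_comp T S f) \<le> (\<bar>opnorm X T\<bar> * opnorm X S) * l2norm f" if "f \<in> ell2 X" for f
  proof -
    have "l2norm (op_comp T S f) \<le> opnorm X T * l2norm (S f)"
      unfolding op_comp_def by (rule opnorm_bound[OF T bounded_op_ell2[OF S that]])
    also have "\<dots> \<le> \<bar>opnorm X T\<bar> * l2norm (S f)"
      by (intro mult_right_mono l2norm_nonneg) auto
    also have "\<dots> \<le> \<bar>opnorm X T\<bar> * (opnorm X S * l2norm f)"
      by (intro mult_left_mono opnorm_bound[OF S that]) auto
    finally show ?thesis by (simp add: mult.assoc)
  qed
qed (simp_all add: op_comp_def bounded_op_outside[OF S] bounded_op_zero[OF T] bounded_op_add[OF T]
    bounded_op_add[OF S] bounded_op_scale[OF T] bounded_op_scale[OF S] bounded_op_ell2[OF T]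
    bounded_op_ell2[OF S])

section \<open>The tensor algebra\<close>

locale path_space =
  fixes V :: "'v set" and E :: "'e set" and r s :: "'e \<Rightarrow> 'v"
  assumes graph: "digraph V E r s"
begin

abbreviation paths :: "('v \<times> 'e list) set" where
  "paths \<equiv> fs_paths V E r s"

lemma path_Nil: "(u, []) \<in> paths \<longleftrightarrow> u \<in> V"
  by (auto simp: fs_paths_def)

text \<open>The head of the list is the edge traversed last, and what remains has range
  \<open>s e\<close>. The pair \<open>(s e, es)\<close> covers both cases: it is a vertex for empty
  \<open>es\<close>, and otherwise \<open>s e = r (hd es)\<close> by composability. Path arguments
  thus become list recursions.\<close>

lemma path_Cons: "(u, e # es) \<in> paths \<longleftrightarrow> u = r e \<and> e \<in> E \<and> (s e, es) \<in> paths"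
proof (cases es)
  case Nil
  then show ?thesis
    using graph by (auto simp: fs_paths_def digraph_def)
next
  case (Cons e' es')
  have "(\<forall>i. Suc i < length (e # es) \<longrightarrow> s ((e # es) ! i) = r ((e # es) ! Suc i)) \<longleftrightarrow>
    s e = r (hd es) \<and> (\<forall>i. Suc i < length es \<longrightarrow> s (es ! i) = r (es ! Suc i))"
    using Cons by (auto simp: less_Suc_eq_0_disj nth_Cons split: nat.split)
  then show ?thesis
    using Cons by (auto simp: fs_paths_def)
qed

lemma path_range: "(u, es) \<in> paths \<Longrightarrow> es \<noteq> [] \<Longrightarrow> r (hd es) = u"
  by (auto simp: fs_paths_def)

lemma path_range_in_V: "(u, es) \<in> paths \<Longrightarrow> u \<in> V"
  using graph by (cases es) (auto simp: path_Nil path_Cons digraph_def)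

lemma path_snocD: "(u, es @ [e]) \<in> paths \<Longrightarrow> (u, es) \<in> paths"
proof (induction es arbitrary: u)
  case Nil
  then show ?case
    using graph by (auto simp: path_Cons path_Nil digraph_def)
qed (auto simp: path_Cons)

text \<open>This is the sum of the operators \<open>t e\<close> times L_e, written without a series:
  a path of positive length has exactly one leftmost edge, so only one term contributes to its
  coefficient.\<close>

definition weighted_shift :: "('e \<Rightarrow> real) \<Rightarrow> ('v \<times> 'e list) op" where
  "weighted_shift t = (\<lambda>f. if f \<in> ell2 paths
     then (\<lambda>(u, es). case es of [] \<Rightarrow> 0
             | e # es' \<Rightarrow> if (u, es) \<in> paths then of_real (t e) * f (s e, es') else 0)
     else (\<lambda>_. 0))"

lemma weighted_shift_outside: "f \<notin> ell2 paths \<Longrightarrow> weighted_shift t f = (\<lambda>_. 0)"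
  by (simp add: weighted_shift_def)

lemma weighted_shift_Nil: "weighted_shift t f (u, []) = 0"
  by (simp add: weighted_shift_def)

lemma weighted_shift_Cons:
  "f \<in> ell2 paths \<Longrightarrow>
    weighted_shift t f (u, e # es) = (if u = r e \<and> e \<in> E then of_real (t e) * f (s e, es) else 0)"
  by (auto simp: weighted_shift_def path_Cons ell2_eq_0)

text \<open>Facts about weighted shifts thereby specialise to the edge operators. The two branches
  in \<open>L_op\<close> merge because \<open>r (hd es') = s e\<close> on nonempty remainders of
  paths.\<close>

lemma L_op_eq: "L_op V E r s e = weighted_shift (\<lambda>e'. if e' = e then 1 else 0)"
  by (intro ext) (auto simp: L_op_def weighted_shift_def path_Cons path_range split: list.split)

text \<open>A coefficient of the image at a path e w is \<open>t e\<close> times that of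
  \<open>f\<close> at w. Since the pair (e, w) determines the path, the sum of squares is dominated
  by the product of the sums over edges and over paths.\<close>

lemma
  assumes t: "\<And>G. finite G \<Longrightarrow> G \<subseteq> E \<Longrightarrow> (\<Sum>e\<in>G. (t e)\<^sup>2) \<le> c\<^sup>2" and c: "c \<ge> 0"
    and f: "f \<in> ell2 paths"
  shows weighted_shift_ell2: "weighted_shift t f \<in> ell2 paths"
    and weighted_shift_norm: "l2norm (weighted_shift t f) \<le> c * l2norm f"
proof -
  let ?W = "weighted_shift t f"
  have zero: "?W w = 0" if "w \<notin> paths" for w
    using that f by (cases w; cases "snd w") (auto simp: weighted_shift_def)
  have "L2_set (\<lambda>w. cmod (?W w)) F \<le> c * l2norm f" if fin: "finite F" for F
  proof -
    define F' where "F' = {w \<in> F. w \<in> paths \<and> snd w \<noteq> []}"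
    define h where "h w = (hd (snd w), (s (hd (snd w)), tl (snd w)))" for w :: "'v \<times> 'e list"
    have F': "finite F'"
      using fin by (simp add: F'_def)
    have inj: "inj_on h F'"
      by (rule inj_onI) (auto simp: F'_def h_def path_Cons neq_Nil_conv)
    have "(\<Sum>w\<in>F. (cmod (?W w))\<^sup>2) = (\<Sum>w\<in>F'. (cmod (?W w))\<^sup>2)"
      using fin by (intro sum.mono_neutral_right)
        (use zero in \<open>fastforce simp: F'_def weighted_shift_Nil\<close>)+
    also have "\<dots> = (\<Sum>w\<in>F'. (case h w of (e, y) \<Rightarrow> (t e)\<^sup>2 * (cmod (f y))\<^sup>2))"
      using f by (intro sum.cong)
        (auto simp: F'_def h_def neq_Nil_conv weighted_shift_Cons path_Cons norm_mult power_mult_distrib)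
    also have "\<dots> = (\<Sum>(e, y)\<in>h ` F'. (t e)\<^sup>2 * (cmod (f y))\<^sup>2)"
      using inj by (simp add: sum.reindex o_def)
    \<comment> \<open>Enlarging the index set to a rectangle adds only nonnegative terms and makes
      the sum factor.\<close>
    also have "\<dots> \<le> (\<Sum>(e, y)\<in>(fst ` h ` F') \<times> (snd ` h ` F'). (t e)\<^sup>2 * (cmod (f y))\<^sup>2)"
    proof (rule sum_mono2)
      show "h ` F' \<subseteq> (fst ` h ` F') \<times> (snd ` h ` F')"
        by (rule subset_fst_snd)
    qed (use F' in auto)
    also have "\<dots> = (\<Sum>e\<in>fst ` h ` F'. (t e)\<^sup>2) * (\<Sum>y\<in>snd ` h ` F'. (cmod (f y))\<^sup>2)"
      by (simp add: sum_product sum.cartesian_product)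
    also have "\<dots> \<le> c\<^sup>2 * (l2norm f)\<^sup>2"
    proof (rule mult_mono)
      show "(\<Sum>e\<in>fst ` h ` F'. (t e)\<^sup>2) \<le> c\<^sup>2"
        using F' by (intro t) (auto simp: F'_def h_def path_Cons neq_Nil_conv)
      show "(\<Sum>y\<in>snd ` h ` F'. (cmod (f y))\<^sup>2) \<le> (l2norm f)\<^sup>2"
        using L2_set_le_l2norm[OF f, of "snd ` h ` F'"] unfolding L2_set_def by (rule sqrt_le_D)
    qed (auto intro: sum_nonneg)
    finally show ?thesis
      using c l2norm_nonneg[of f] unfolding L2_set_def
      by (intro real_le_lsqrt) (auto simp: power_mult_distrib)
  qed
  with zero show "?W \<in> ell2 paths" "l2norm ?W \<le> c * l2norm f"
    by (auto intro: ell2I[where c = "c * l2norm f"] l2norm_le)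
qed

lemma bounded_op_weighted_shift:
  assumes t: "\<And>G. finite G \<Longrightarrow> G \<subseteq> E \<Longrightarrow> (\<Sum>e\<in>G. (t e)\<^sup>2) \<le> c\<^sup>2" and c: "c \<ge> 0"
  shows "bounded_op paths (weighted_shift t)"
proof (rule bounded_opI)
  show "weighted_shift t (\<lambda>w. f w + g w) = (\<lambda>w. weighted_shift t f w + weighted_shift t g w)"
    if "f \<in> ell2 paths" "g \<in> ell2 paths" for f g
    using that by (auto simp: weighted_shift_def ell2_add algebra_simps fun_eq_iff split: list.split)
  show "weighted_shift t (\<lambda>w. k * f w) = (\<lambda>w. k * weighted_shift t f w)"
    if "f \<in> ell2 paths" for f k
    using that by (auto simp: weighted_shift_def ell2_scale fun_eq_iff split: list.split)
qed (use weighted_shift_ell2[OF t c] weighted_shift_norm[OF t c] in \<open>auto simp: weighted_shift_outside\<close>)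

lemma bounded_op_L_op: "bounded_op paths (L_op V E r s e)"
  unfolding L_op_eq
proof (rule bounded_op_weighted_shift[where c = 1])
  show "(\<Sum>e'\<in>G. (if e' = e then 1 else 0)\<^sup>2) \<le> (1::real)\<^sup>2" if "finite G" for G
    using that sum.delta[of G e "\<lambda>_. 1::real"] by (simp add: if_distrib[of "\<lambda>x. x\<^sup>2"] cong: if_cong)
qed simp

lemma P_op_eq: "f \<in> ell2 paths \<Longrightarrow> P_op V E r s v f = (\<lambda>w. if w \<in> {w. fst w = v} then f w else 0)"
  by (auto simp: P_op_def fun_eq_iff ell2_eq_0)

lemma bounded_op_P_op: "bounded_op paths (P_op V E r s v)"
proof (rule bounded_opI)
  show "l2norm (P_op V E r s v f) \<le> 1 * l2norm f" if "f \<in> ell2 paths" for f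
    using l2norm_restrict[OF that] by (simp only: P_op_eq[OF that] mult_1)
  show "P_op V E r s v f \<in> ell2 paths" if "f \<in> ell2 paths" for f
    using ell2_restrict[OF that] by (simp only: P_op_eq[OF that])
qed (auto simp: P_op_eq ell2_add ell2_scale P_op_def fun_eq_iff)

lemma bounded_op_gen_alg: "T \<in> gen_alg V E r s \<Longrightarrow> bounded_op paths T"
  by (induction rule: gen_alg.induct)
    (auto intro: bounded_op_P_op bounded_op_L_op bounded_op_op_add bounded_op_op_comp bounded_op_op_scale)

lemma bounded_op_tensor_alg: "T \<in> tensor_alg V E r s \<Longrightarrow> bounded_op paths T"
  by (simp add: tensor_alg_def)

text \<open>Uniform closeness of single coefficients is enough to carry coefficient identities from
  the generated algebra to its norm closure.\<close>

lemma tensor_alg_approx: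
  assumes T: "T \<in> tensor_alg V E r s" and e: "e > 0"
  obtains S where "S \<in> gen_alg V E r s"
    and "\<And>f w. f \<in> ell2 paths \<Longrightarrow> cmod (T f w - S f w) \<le> e * l2norm f"
proof -
  obtain S where S: "S \<in> gen_alg V E r s" "opnorm paths (op_diff T S) < e"
    using T e by (auto simp: tensor_alg_def)
  have "cmod (T f w - S f w) \<le> e * l2norm f" if f: "f \<in> ell2 paths" for f w
  proof -
    have "bounded_op paths (op_diff T S)"
      using T S(1) by (intro bounded_op_op_diff bounded_op_gen_alg bounded_op_tensor_alg)
    then have "cmod (op_diff T S f w) \<le> opnorm paths (op_diff T S) * l2norm f"
      using f by (rule norm_bounded_op_le)
    also have "\<dots> \<le> e * l2norm f"
      using S(2) by (intro mult_right_mono l2norm_nonneg) auto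
    finally show ?thesis
      by (simp add: op_diff_def)
  qed
  with S(1) show ?thesis
    by (rule that)
qed

section \<open>The filtration by path length\<close>

definition vanishes_below :: "nat \<Rightarrow> ('v \<times> 'e list \<Rightarrow> complex) \<Rightarrow> bool" where
  "vanishes_below k g \<longleftrightarrow> (\<forall>u es. length es < k \<longrightarrow> g (u, es) = 0)"

lemma vanishes_below_weighted_shift:
  assumes "g \<in> ell2 paths" "vanishes_below k g"
  shows "vanishes_below (Suc k) (weighted_shift t g)"
  unfolding vanishes_below_def
proof (intro allI impI)
  fix u :: 'v and es :: "'e list" assume "length es < Suc k"
  with assms show "weighted_shift t g (u, es) = 0"
    by (cases es) (auto simp: weighted_shift_Nil weighted_shift_Cons vanishes_below_def)
qed

lemma vanishes_below_mono: "vanishes_below k g \<Longrightarrow> j \<le> k \<Longrightarrow> vanishes_below j g"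
  by (auto simp: vanishes_below_def)

text \<open>No generator shortens a path: vertex projections preserve the length and edge operators
  raise it by one.\<close>

lemma vanishes_below_gen_alg:
  "T \<in> gen_alg V E r s \<Longrightarrow> g \<in> ell2 paths \<Longrightarrow> vanishes_below k g \<Longrightarrow> vanishes_below k (T g)"
proof (induction arbitrary: g rule: gen_alg.induct)
  case (gen_P v)
  then show ?case by (auto simp: P_op_eq vanishes_below_def)
next
  case (gen_L e)
  then show ?case
    unfolding L_op_eq
    by (intro vanishes_below_mono[OF vanishes_below_weighted_shift[of g k]]) auto
next
  case (gen_comp T S)
  then show ?case
    by (simp add: op_comp_def bounded_op_ell2[OF bounded_op_gen_alg])
qed (auto simp: op_add_def op_scale_def vanishes_below_def)

lemma vanishes_below_tensor_alg:
  assumes T: "T \<in> tensor_alg V E r s" and g: "g \<in> ell2 paths" and van: "vanishes_below k g"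
  shows "vanishes_below k (T g)"
  unfolding vanishes_below_def
proof (intro allI impI)
  fix u :: 'v and es :: "'e list" assume len: "length es < k"
  have "cmod (T g (u, es)) \<le> 0 + e" if e: "e > 0" for e
  proof -
    \<comment> \<open>Adding 1 keeps the denominator positive when \<open>g\<close> is zero.\<close>
    let ?d = "e / (l2norm g + 1)"
    have pos: "l2norm g + 1 > 0"
      using l2norm_nonneg[of g] by linarith
    then obtain S where S: "S \<in> gen_alg V E r s"
      and app: "cmod (T g (u, es) - S g (u, es)) \<le> ?d * l2norm g"
      using tensor_alg_approx[OF T, of ?d] e g by (metis divide_pos_pos)
    have "S g (u, es) = 0"
      using vanishes_below_gen_alg[OF S g van] len by (simp add: vanishes_below_def)
    moreover have "?d * l2norm g \<le> e"
      using e pos by (simp add: field_simps)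
    ultimately show ?thesis
      using app by simp
  qed
  then have "cmod (T g (u, es)) \<le> 0"
    by (rule field_le_epsilon)
  then show "T g (u, es) = 0"
    by simp
qed

section \<open>Adjoints of the right translations \<xi>_w \<mapsto> \<xi>_{we}\<close>

definition strip :: "'e \<Rightarrow> ('v \<times> 'e list \<Rightarrow> complex) \<Rightarrow> ('v \<times> 'e list \<Rightarrow> complex)" where
  "strip e g = (\<lambda>(u, es). g (u, es @ [e]))"

lemma strip_apply: "strip e g (u, es) = g (u, es @ [e])"
  by (simp add: strip_def)

lemma ell2_strip:
  assumes g: "g \<in> ell2 paths"
  shows "strip e g \<in> ell2 paths"
proof (rule ell2I)
  show "strip e g w = 0" if "w \<notin> paths" for w
    using that by (cases w) (auto simp: strip_apply intro: ell2_eq_0[OF g] dest: path_snocD)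
  show "L2_set (\<lambda>w. cmod (strip e g w)) F \<le> l2norm g" if "finite F" for F
  proof -
    let ?h = "\<lambda>(u, es). (u, es @ [e]) :: 'v \<times> 'e list"
    have "inj_on ?h F"
      by (auto simp: inj_on_def)
    then have "L2_set (\<lambda>w. cmod (strip e g w)) F = L2_set (\<lambda>w. cmod (g w)) (?h ` F)"
      by (simp add: L2_set_def sum.reindex strip_def o_def case_prod_unfold)
    also have "\<dots> \<le> l2norm g"
      by (rule L2_set_le_l2norm[OF g])
    finally show ?thesis .
  qed
qed

text \<open>Removing the first traversed edge commutes with the algebra only on functions vanishing at
  vertices: on a vertex \<open>u\<close>, the operator \<open>L_op V E r s e\<close> creates the very edge that \<open>strip e\<close> removes.\<close>

lemma strip_weighted_shift:
  assumes g: "g \<in> ell2 paths" and van: "vanishes_below 1 g"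
  shows "strip e (weighted_shift t g) = weighted_shift t (strip e g)"
proof
  fix w :: "'v \<times> 'e list"
  show "strip e (weighted_shift t g) w = weighted_shift t (strip e g) w"
    using van ell2_strip[OF g, of e] g
    by (cases w; cases "snd w")
      (auto simp: strip_apply weighted_shift_Nil weighted_shift_Cons vanishes_below_def)
qed

lemma strip_gen_alg:
  "T \<in> gen_alg V E r s \<Longrightarrow> g \<in> ell2 paths \<Longrightarrow> vanishes_below 1 g \<Longrightarrow> strip e (T g) = T (strip e g)"
proof (induction arbitrary: g rule: gen_alg.induct)
  case (gen_P v)
  then show ?case by (auto simp: P_op_eq ell2_strip strip_apply fun_eq_iff)
next
  case (gen_L e')
  then show ?case
    unfolding L_op_eq by (intro strip_weighted_shift)
next
  \<comment> \<open>The hypothesis for \<open>T\<close> applies to \<open>S g\<close> because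
    \<open>S g\<close> again vanishes at the vertices.\<close>
  case (gen_comp T S)
  then show ?case
    by (simp add: op_comp_def bounded_op_ell2[OF bounded_op_gen_alg] vanishes_below_gen_alg)
qed (auto simp: op_add_def op_scale_def strip_def fun_eq_iff)

lemma strip_tensor_alg:
  assumes T: "T \<in> tensor_alg V E r s" and g: "g \<in> ell2 paths" and van: "vanishes_below 1 g"
  shows "strip e (T g) = T (strip e g)"
proof
  fix w :: "'v \<times> 'e list"
  obtain u es where w: "w = (u, es)"
    by (cases w)
  let ?N = "l2norm g + l2norm (strip e g)"
  have "cmod (strip e (T g) w - T (strip e g) w) \<le> 0 + d" if d: "d > 0" for d
  proof -
    let ?d = "d / (?N + 1)"
    have pos: "?N + 1 > 0"
      using l2norm_nonneg[of g] l2norm_nonneg[of "strip e g"] by linarith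
    then obtain S where S: "S \<in> gen_alg V E r s"
      and app: "\<And>f w. f \<in> ell2 paths \<Longrightarrow> cmod (T f w - S f w) \<le> ?d * l2norm f"
      using tensor_alg_approx[OF T, of ?d] d by (metis divide_pos_pos)
    \<comment> \<open>For \<open>S\<close> the two sides agree exactly, so for \<open>T\<close> they
      differ by at most two approximation errors.\<close>
    have "S g (u, es @ [e]) = S (strip e g) w"
      using strip_gen_alg[OF S g van] w by (metis strip_apply)
    then have "cmod (strip e (T g) w - T (strip e g) w)
      = cmod ((T g (u, es @ [e]) - S g (u, es @ [e])) - (T (strip e g) w - S (strip e g) w))"
      by (simp add: w strip_apply)
    also have "\<dots> \<le> cmod (T g (u, es @ [e]) - S g (u, es @ [e]))
      + cmod (T (strip e g) w - S (strip e g) w)"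
      by (rule norm_triangle_ineq4)
    also have "\<dots> \<le> ?d * l2norm g + ?d * l2norm (strip e g)"
      by (intro add_mono app g ell2_strip)
    also have "\<dots> = ?d * ?N"
      by (simp add: distrib_left)
    also have "\<dots> \<le> d"
      using d pos by (simp add: field_simps)
    finally show ?thesis by simp
  qed
  then have "cmod (strip e (T g) w - T (strip e g) w) \<le> 0"
    by (rule field_le_epsilon)
  then show "strip e (T g) w = T (strip e g) w"
    by simp
qed

section \<open>Weighted shifts as norm limits of generated operators\<close>

lemma weighted_shift_finite_gen_alg:
  assumes "gen_alg V E r s \<noteq> {}" and "finite G" and "G \<subseteq> E"
  shows "weighted_shift (\<lambda>e. if e \<in> G then t e else 0) \<in> gen_alg V E r s"
  using assms(2,3)
proof (induction rule: finite_induct)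
  case empty
  \<comment> \<open>The zero operator is 0 times some generated element; for the empty graph there
    is none.\<close>
  obtain T where "T \<in> gen_alg V E r s"
    using assms(1) by blast
  then have "op_scale 0 T \<in> gen_alg V E r s"
    by (rule gen_scale)
  also have "op_scale 0 T = weighted_shift (\<lambda>e. if e \<in> {} then t e else 0)"
    by (auto simp: op_scale_def weighted_shift_def fun_eq_iff split: list.split)
  finally show ?case .
next
  case (insert e G)
  have "weighted_shift (\<lambda>e'. if e' \<in> insert e G then t e' else 0)
    = op_add (op_scale (of_real (t e)) (L_op V E r s e)) (weighted_shift (\<lambda>e. if e \<in> G then t e else 0))"
    using insert.hyps unfolding L_op_eq
    by (auto simp: op_add_def op_scale_def weighted_shift_def fun_eq_iff split: list.split)
  then show ?case
    using insert by (auto intro: gen_add gen_scale gen_L)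
qed

text \<open>The operator norm is controlled by the square sum of the weights. Cutting the weights
  down to a finite set of edges therefore leaves an error bounded by the l2 tail.\<close>

lemma weighted_shift_tensor_alg:
  assumes ne: "gen_alg V E r s \<noteq> {}" and t: "(\<lambda>e. (t e)\<^sup>2) summable_on E"
  shows "weighted_shift t \<in> tensor_alg V E r s"
proof -
  let ?I = "infsum (\<lambda>e. (t e)\<^sup>2) E"
  have le: "(\<Sum>e\<in>G. (t e)\<^sup>2) \<le> ?I" if "finite G" "G \<subseteq> E" for G
    using that by (intro finite_sum_le_infsum t) auto
  have "bounded_op paths (weighted_shift t)"
    by (rule bounded_op_weighted_shift[where c = "sqrt ?I"]) (use le in \<open>auto simp: infsum_nonneg\<close>)
  moreover have "\<exists>S\<in>gen_alg V E r s. opnorm paths (op_diff (weighted_shift t) S) < \<epsilon>"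
    if eps: "\<epsilon> > 0" for \<epsilon>
  proof -
    obtain G where G: "finite G" "G \<subseteq> E" "dist (\<Sum>e\<in>G. (t e)\<^sup>2) ?I \<le> (\<epsilon>/2)\<^sup>2"
      using infsum_finite_approximation[OF t, of "(\<epsilon>/2)\<^sup>2"] eps by auto
    let ?t = "\<lambda>e. if e \<in> G then 0 else t e"
    let ?S = "weighted_shift (\<lambda>e. if e \<in> G then t e else 0)"
    have tail: "(\<Sum>e\<in>H. (?t e)\<^sup>2) \<le> (\<epsilon>/2)\<^sup>2" if H: "finite H" "H \<subseteq> E" for H
    proof -
      have "(\<Sum>e\<in>H. (?t e)\<^sup>2) = (\<Sum>e\<in>H - G. (t e)\<^sup>2)"
        using H by (auto intro!: sum.mono_neutral_cong_right)
      also have "\<dots> = (\<Sum>e\<in>H \<union> G. (t e)\<^sup>2) - (\<Sum>e\<in>G. (t e)\<^sup>2)"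
        using H G(1) sum.union_disjoint[of "H - G" G "\<lambda>e. (t e)\<^sup>2"] by (auto simp: Int_commute)
      also have "\<dots> \<le> ?I - (\<Sum>e\<in>G. (t e)\<^sup>2)"
        using le[of "H \<union> G"] H G by simp
      finally show ?thesis
        using G(3) by (simp add: dist_real_def)
    qed
    have "op_diff (weighted_shift t) ?S = weighted_shift ?t"
      by (auto simp: op_diff_def weighted_shift_def fun_eq_iff split: list.split)
    moreover have "opnorm paths (weighted_shift ?t) \<le> \<epsilon>/2"
    proof (rule opnorm_le)
      fix f assume f: "f \<in> ell2 paths" "l2norm f \<le> 1"
      have "l2norm (weighted_shift ?t f) \<le> \<epsilon>/2 * l2norm f"
        using eps f(1) by (intro weighted_shift_norm tail) auto
      also have "\<dots> \<le> \<epsilon>/2"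
        using eps f(2) by (simp add: mult_left_le)
      finally show "l2norm (weighted_shift ?t f) \<le> \<epsilon>/2" .
    qed
    ultimately show ?thesis
      using weighted_shift_finite_gen_alg[OF ne G(1,2)] eps by (intro bexI[of _ ?S]) auto
  qed
  ultimately show ?thesis
    by (simp add: tensor_alg_def)
qed

end

section \<open>Epimorphisms onto the tensor algebra\<close>

locale tensor_epimorphism = path_space V E r s
  for V :: "'v set" and E :: "'e set" and r s :: "'e \<Rightarrow> 'v" +
  fixes smul :: "complex \<Rightarrow> 'a::{banach, real_normed_algebra} \<Rightarrow> 'a"
    and \<phi> :: "'a \<Rightarrow> ('v \<times> 'e list) op"
  assumes countable_E: "countable E"
    and algebra: "complex_banach_algebra smul"
    and hom: "op_alg_hom smul \<phi>"
    and onto: "range \<phi> = tensor_alg V E r s"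
begin

lemma phi_add: "\<phi> (x + y) = op_add (\<phi> x) (\<phi> y)"
  and phi_mult: "\<phi> (x * y) = op_comp (\<phi> x) (\<phi> y)"
  using hom by (auto simp: op_alg_hom_def)

lemma phi_scaleR: "\<phi> (t *\<^sub>R x) = op_scale (of_real t) (\<phi> x)"
  using hom algebra unfolding op_alg_hom_def complex_banach_algebra_def by metis

lemma phi_tensor_alg: "\<phi> x \<in> tensor_alg V E r s"
  using onto by auto

lemma bounded_op_phi: "bounded_op paths (\<phi> x)"
  by (rule bounded_op_tensor_alg[OF phi_tensor_alg])

text \<open>This expresses continuity of one matrix coefficient of \<phi>, the linear functional
  that pairs \<open>\<phi> x f\<close> with \<xi>_w.\<close>

definition bounded_coeff :: "('v \<times> 'e list \<Rightarrow> complex) \<Rightarrow> 'v \<times> 'e list \<Rightarrow> bool" where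
  "bounded_coeff f w \<longleftrightarrow> (\<exists>K. \<forall>x. cmod (\<phi> x f w) \<le> K * norm x)"

lemma seminorm_coeff: "seminorm (\<lambda>x. cmod (\<phi> x f w))"
  by (auto simp: seminorm_def phi_add phi_scaleR op_add_def op_scale_def norm_mult norm_triangle_ineq)

lemma weighted_shift_in_range:
  obtains a t where "norm a \<le> 1" and "\<And>e. e \<in> E \<Longrightarrow> t e > 0" and "\<phi> a = weighted_shift t"
proof -
  \<comment> \<open>Distinct edges receive distinct powers of 1/2, so the squares are dominated by a
    geometric series of ratio 1/4.\<close>
  define t :: "'e \<Rightarrow> real" where "t e = (1/2) ^ to_nat_on E e" for e
  have "((1/2::real) ^ n)\<^sup>2 = (1/4) ^ n" for n
    by (simp add: power2_eq_square flip: power_mult_distrib)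
  then have "(\<lambda>n. ((1/2::real) ^ n)\<^sup>2) summable_on UNIV"
    by (intro norm_summable_imp_summable_on) (simp add: summable_geometric)
  then have "(\<lambda>n. ((1/2::real) ^ n)\<^sup>2) summable_on (to_nat_on E ` E)"
    by (rule summable_on_subset_banach) auto
  then have "(\<lambda>e. (t e)\<^sup>2) summable_on E"
    using summable_on_reindex[OF inj_on_to_nat_on[OF countable_E], of "\<lambda>n. ((1/2::real) ^ n)\<^sup>2"]
    unfolding t_def o_def by blast
  \<comment> \<open>The range of \<phi> is nonempty, and each of its elements is approximated by
    generated operators.\<close>
  moreover have "gen_alg V E r s \<noteq> {}"
    using phi_tensor_alg unfolding tensor_alg_def by (auto intro: zero_less_one)
  ultimately have "weighted_shift t \<in> tensor_alg V E r s"
    by (intro weighted_shift_tensor_alg)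
  then obtain a where a: "\<phi> a = weighted_shift t"
    by (metis onto imageE)
  \<comment> \<open>Rescaling makes multiplication by the preimage a contraction, as
    \<open>gliding_hump\<close> demands; the weights stay positive.\<close>
  define c where "c = 1 / (norm a + 1)"
  have c: "c > 0"
    unfolding c_def by (intro divide_pos_pos add_nonneg_pos) auto
  show ?thesis
  proof (rule that)
    show "norm (c *\<^sub>R a) \<le> 1"
      unfolding c_def by (simp add: add_nonneg_pos)
    show "c * t e > 0" for e
      using c by (simp add: t_def)
    show "\<phi> (c *\<^sub>R a) = weighted_shift (\<lambda>e. c * t e)"
      by (auto simp: phi_scaleR a op_scale_def weighted_shift_def fun_eq_iff split: list.split)
  qed
qed

end

section \<open>Coefficients along extended paths\<close>

locale shift_preimage = tensor_epimorphism V E r s smul \<phi>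
  for V :: "'v set" and E :: "'e set" and r s :: "'e \<Rightarrow> 'v"
    and smul :: "complex \<Rightarrow> 'a::{banach, real_normed_algebra} \<Rightarrow> 'a"
    and \<phi> :: "'a \<Rightarrow> ('v \<times> 'e list) op" +
  fixes a :: 'a and t :: "'e \<Rightarrow> real"
  assumes norm_a: "norm a \<le> 1"
    and t_pos: "\<And>e. e \<in> E \<Longrightarrow> t e > 0"
    and phi_a: "\<phi> a = weighted_shift t"
begin

abbreviation "W \<equiv> weighted_shift t"

lemma bounded_op_W: "bounded_op paths W"
  using bounded_op_phi[of a] by (simp add: phi_a)

lemma W_pow_ell2: "g \<in> ell2 paths \<Longrightarrow> (W ^^ k) g \<in> ell2 paths"
  by (induction k) (auto intro: bounded_op_ell2[OF bounded_op_W])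

lemma W_pow_vanishes_below: "g \<in> ell2 paths \<Longrightarrow> vanishes_below k ((W ^^ k) g)"
proof (induction k)
  case 0
  show ?case by (simp add: vanishes_below_def)
next
  case (Suc k)
  then show ?case
    using vanishes_below_weighted_shift[OF W_pow_ell2] by simp
qed

lemma W_pow_scale: "g \<in> ell2 paths \<Longrightarrow> (W ^^ k) (\<lambda>w. c * g w) = (\<lambda>w. c * (W ^^ k) g w)"
  by (induction k) (auto simp: bounded_op_scale[OF bounded_op_W] W_pow_ell2)

lemma W_pow_strip:
  assumes g: "g \<in> ell2 paths" and van: "vanishes_below 1 g"
  shows "strip e ((W ^^ k) g) = (W ^^ k) (strip e g)"
proof -
  have "strip e ((W ^^ k) g) = (W ^^ k) (strip e g) \<and> vanishes_below 1 ((W ^^ k) g)"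
  proof (induction k)
    case 0
    show ?case using van by simp
  next
    case (Suc k)
    then show ?case
      using strip_weighted_shift[OF W_pow_ell2[OF g]]
        vanishes_below_mono[OF W_pow_vanishes_below[OF g, of "Suc k"], of 1]
      by simp
  qed
  then show ?thesis by simp
qed

lemma phi_left_mult: "\<phi> (((*) a ^^ k) x) f = (W ^^ k) (\<phi> x f)"
  by (induction k) (simp_all add: phi_mult op_comp_def phi_a)

text \<open>Left multiplication by \<open>a\<close> acts on the output vector, right multiplication
  on the input vector. The induction keeps \<open>f\<close> arbitrary because the innermost factor W
  meets \<open>f\<close> first.\<close>

lemma phi_right_mult: "\<phi> (((\<lambda>x. x * a) ^^ k) x) f = \<phi> x ((W ^^ k) f)"
  by (induction k arbitrary: f) (simp_all add: phi_mult op_comp_def phi_a funpow_swap1)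

lemma norm_left_mult_a: "norm (a * x) \<le> norm x" and norm_right_mult_a: "norm (x * a) \<le> norm x"
proof -
  have "norm a * norm x \<le> norm x"
    using norm_a by (simp add: mult_left_le_one_le)
  then show "norm (a * x) \<le> norm x" "norm (x * a) \<le> norm x"
    using norm_mult_ineq[of a x] norm_mult_ineq[of x a] by (auto simp: mult.commute)
qed

text \<open>Without sinks an edge can always be prepended at the range of a path. Each application
  of \<open>W\<close> at the longer path returns the coefficient at the shorter one times the weight
  of the new edge, so \<open>C\<close> is the product of the weights along \<open>p\<close>.\<close>

lemma extend_path_forward:
  assumes "no_sinks V E s" and w: "(v, es) \<in> paths"
  shows "\<exists>u p C. (u, p @ es) \<in> paths \<and> length p = k \<and> C \<noteq> 0 \<and>
    (\<forall>g\<in>ell2 paths. (W ^^ k) g (u, p @ es) = C * g (v, es))"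
proof (induction k)
  case 0
  show ?case
    using w by (intro exI[of _ v] exI[of _ "[]"] exI[of _ 1]) simp
next
  case (Suc k)
  then obtain u p C where p: "(u, p @ es) \<in> paths" "length p = k" "C \<noteq> 0"
    "\<And>g. g \<in> ell2 paths \<Longrightarrow> (W ^^ k) g (u, p @ es) = C * g (v, es)"
    by blast
  obtain e where e: "e \<in> E" "s e = u"
    using assms(1) path_range_in_V[OF p(1)] by (auto simp: no_sinks_def)
  have "(W ^^ Suc k) g (r e, (e # p) @ es) = of_real (t e) * C * g (v, es)" if "g \<in> ell2 paths" for g
    using that e p(4) by (simp add: weighted_shift_Cons[OF W_pow_ell2])
  moreover have "of_real (t e) * C \<noteq> 0"
    using p(3) t_pos[OF e(1)] by simp
  moreover have "(r e, (e # p) @ es) \<in> paths"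
    using e p(1) by (simp add: path_Cons)
  ultimately show ?case
    using p(2) by (intro exI[of _ "r e"] exI[of _ "e # p"] exI[of _ "of_real (t e) * C"]) auto
qed

lemma bounded_coeff_no_sinks:
  assumes ns: "no_sinks V E s" and f: "f \<in> ell2 paths" and w: "(v, es) \<in> paths"
  shows "bounded_coeff f (v, es)"
proof -
  \<comment> \<open>With this block size the n-th extended path has length
    \<open>l * n + length es\<close>, which is less than \<open>l * Suc n\<close>. Hence one more
    block of \<open>W\<close> kills its coefficient, and the bound for \<open>M ^^ Suc n\<close>
    holds with constant 0.\<close>
  define l where "l = Suc (length es)"
  obtain u p C where len: "\<And>k. length (p k) = k" and C: "\<And>k. C k \<noteq> 0"
    and ext: "\<And>k g. g \<in> ell2 paths \<Longrightarrow> (W ^^ k) g (u k, p k @ es) = C k * g (v, es)"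
    using extend_path_forward[OF ns w] by metis
  define M where "M = (*) a ^^ l"
  have Mn: "(M ^^ n) = (*) a ^^ (l * n)" for n
    by (simp add: M_def funpow_mult mult.commute)
  define q where "q n x = cmod (\<phi> x f (u (l * n), p (l * n) @ es))" for n x
  have "\<exists>n K. \<forall>x. q n ((M ^^ n) x) \<le> K * norm x"
  proof (rule gliding_hump)
    show "bounded_linear M"
      unfolding M_def by (intro bounded_linear_funpow bounded_linear_mult_right)
    show "norm (M x) \<le> norm x" for x
      unfolding M_def by (rule norm_funpow_le[OF norm_left_mult_a])
    show "seminorm (q n)" for n
      unfolding q_def by (rule seminorm_coeff)
    show "\<exists>B. \<forall>n. q n x \<le> B" for x
      unfolding q_def using norm_bounded_op_le[OF bounded_op_phi f] by blast
    show "\<exists>K. \<forall>x. q n ((M ^^ Suc n) x) \<le> K * norm x" for n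
    proof (intro exI[of _ 0] allI)
      fix x
      have "vanishes_below (l * Suc n) ((W ^^ (l * Suc n)) (\<phi> x f))"
        by (intro W_pow_vanishes_below bounded_op_ell2[OF bounded_op_phi] f)
      then show "q n ((M ^^ Suc n) x) \<le> 0 * norm x"
        unfolding Mn q_def phi_left_mult by (simp add: vanishes_below_def len l_def)
    qed
  qed
  then obtain n K where K: "\<And>x. q n ((M ^^ n) x) \<le> K * norm x"
    by blast
  \<comment> \<open>The coefficient at the extended path is \<open>C (l * n)\<close> times the one
    sought, so dividing by the nonzero constant transfers the bound.\<close>
  have "cmod (\<phi> x f (v, es)) \<le> K / cmod (C (l * n)) * norm x" for x
    using K[of x] C[of "l * n"] ext[OF bounded_op_ell2[OF bounded_op_phi f]]
    by (simp add: q_def Mn phi_left_mult norm_mult field_simps)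
  then show ?thesis
    unfolding bounded_coeff_def by blast
qed

text \<open>Although \<open>(W ^^ k) (ket (u, []))\<close> involves all paths of length \<open>k\<close> from \<open>u\<close>, only \<open>p\<close> contributes
  to a coefficient at a path that starts with \<open>p\<close>.\<close>

lemma extend_path_backward:
  assumes ns: "no_sources V E r" and v: "v \<in> V"
  shows "\<exists>u p C. u \<in> V \<and> length p = k \<and> C \<noteq> 0 \<and> (\<forall>T\<in>tensor_alg V E r s. \<forall>w es.
    T ((W ^^ k) (ket (u, []))) (w, es @ p) = C * T (ket (v, [])) (w, es))"
proof (induction k)
  case 0
  show ?case
    using v by (intro exI[of _ v] exI[of _ "[]"] exI[of _ 1]) simp
next
  case (Suc k)
  then obtain u p C where p: "u \<in> V" "length p = k" "C \<noteq> 0"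
    "\<And>T w es. T \<in> tensor_alg V E r s \<Longrightarrow>
      T ((W ^^ k) (ket (u, []))) (w, es @ p) = C * T (ket (v, [])) (w, es)"
    by blast
  obtain e where e: "e \<in> E" "r e = u"
    using ns p(1) by (auto simp: no_sources_def)
  have sV: "s e \<in> V"
    using graph e(1) by (auto simp: digraph_def)
  have kets: "ket (s e, []) \<in> ell2 paths" "ket (u, []) \<in> ell2 paths"
    using sV p(1) by (auto intro: ell2_ket simp: path_Nil)
  let ?h = "W (ket (s e, []))"
  have h: "?h \<in> ell2 paths"
    by (rule bounded_op_ell2[OF bounded_op_W kets(1)])
  have van: "vanishes_below 1 ?h"
    using W_pow_vanishes_below[OF kets(1), of 1] by simp
  \<comment> \<open>\<open>?h\<close> lives on the edges with source \<open>s e\<close>. Stripping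
    \<open>e\<close> retains only \<open>e\<close> itself, whose remainder is the vertex
    \<open>u = r e\<close>.\<close>
  have "strip e ?h w = of_real (t e) * ket (u, []) w" for w
    using kets e by (cases w; cases "snd w") (auto simp: strip_apply weighted_shift_Cons ket_def)
  then have strip_h: "strip e ?h = (\<lambda>w. of_real (t e) * ket (u, []) w)"
    by blast
  \<comment> \<open>The new edge is traversed first and so stands at the end of the list. Moving
    \<open>strip e\<close> through \<open>T\<close> and \<open>W ^^ k\<close> to \<open>?h\<close>
    reduces the claim to the previous stage.\<close>
  have "T ((W ^^ Suc k) (ket (s e, []))) (w, es @ p @ [e]) = of_real (t e) * C * T (ket (v, [])) (w, es)"
    if T: "T \<in> tensor_alg V E r s" for T w es
  proof -
    have "T ((W ^^ Suc k) (ket (s e, []))) (w, es @ p @ [e]) = strip e (T ((W ^^ k) ?h)) (w, es @ p)"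
      by (simp add: strip_apply funpow_swap1)
    also have "\<dots> = T (strip e ((W ^^ k) ?h)) (w, es @ p)"
    proof -
      have "(W ^^ k) ?h = (W ^^ Suc k) (ket (s e, []))"
        by (simp add: funpow_swap1)
      then have "vanishes_below 1 ((W ^^ k) ?h)"
        using vanishes_below_mono[OF W_pow_vanishes_below[OF kets(1), of "Suc k"], of 1] by simp
      then show ?thesis
        by (simp add: strip_tensor_alg[OF T W_pow_ell2[OF h]])
    qed
    also have "strip e ((W ^^ k) ?h) = (\<lambda>w. of_real (t e) * (W ^^ k) (ket (u, [])) w)"
      by (simp add: W_pow_strip[OF h van] strip_h W_pow_scale[OF kets(2)])
    also have "T \<dots> (w, es @ p) = of_real (t e) * T ((W ^^ k) (ket (u, []))) (w, es @ p)"
      by (simp add: bounded_op_scale[OF bounded_op_tensor_alg[OF T] W_pow_ell2[OF kets(2)]])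
    finally show ?thesis
      by (simp add: p(4)[OF T])
  qed
  moreover have "of_real (t e) * C \<noteq> 0"
    using p(3) t_pos[OF e(1)] by simp
  ultimately show ?case
    using p(2) sV by (intro exI[of _ "s e"] exI[of _ "p @ [e]"] exI[of _ "of_real (t e) * C"]) auto
qed

text \<open>This mirrors the case without sinks: the path is extended at its source, the input
  vertex moves back along the extension, and right multiplication by \<open>a\<close> replaces left
  multiplication.\<close>

lemma bounded_coeff_vertex:
  assumes ns: "no_sources V E r" and v: "v \<in> V"
  shows "bounded_coeff (ket (v, [])) (w, es)"
proof -
  define l where "l = Suc (length es)"
  obtain u p C where u: "\<And>k. u k \<in> V" and len: "\<And>k. length (p k) = k" and C: "\<And>k. C k \<noteq> 0"
    and ext: "\<And>k T w es. T \<in> tensor_alg V E r s \<Longrightarrow>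
      T ((W ^^ k) (ket (u k, []))) (w, es @ p k) = C k * T (ket (v, [])) (w, es)"
    using extend_path_backward[OF ns v] by metis
  have kets: "ket (u k, []) \<in> ell2 paths" for k
    using u by (auto intro: ell2_ket simp: path_Nil)
  define M where "M = (\<lambda>x. x * a) ^^ l"
  have Mn: "(M ^^ n) = (\<lambda>x. x * a) ^^ (l * n)" for n
    by (simp add: M_def funpow_mult mult.commute)
  define q where "q n x = cmod (\<phi> x (ket (u (l * n), [])) (w, es @ p (l * n)))" for n x
  have "\<exists>n K. \<forall>x. q n ((M ^^ n) x) \<le> K * norm x"
  proof (rule gliding_hump)
    show "bounded_linear M"
      unfolding M_def by (intro bounded_linear_funpow bounded_linear_mult_left)
    show "norm (M x) \<le> norm x" for x
      unfolding M_def by (rule norm_funpow_le[OF norm_right_mult_a])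
    show "seminorm (q n)" for n
      unfolding q_def by (rule seminorm_coeff)
    \<comment> \<open>The input vector changes with \<open>n\<close>, but its norm never exceeds
      1.\<close>
    show "\<exists>B. \<forall>n. q n x \<le> B" for x
    proof (intro exI allI)
      fix n
      have "q n x \<le> opnorm paths (\<phi> x) * l2norm (ket (u (l * n), [] :: 'e list))"
        unfolding q_def by (rule norm_bounded_op_le[OF bounded_op_phi kets])
      also have "\<dots> \<le> \<bar>opnorm paths (\<phi> x)\<bar> * 1"
        by (intro mult_mono l2norm_ket l2norm_nonneg) auto
      finally show "q n x \<le> \<bar>opnorm paths (\<phi> x)\<bar> * 1" .
    qed
    show "\<exists>K. \<forall>x. q n ((M ^^ Suc n) x) \<le> K * norm x" for n
    proof (intro exI[of _ 0] allI)
      fix x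
      have "vanishes_below (l * Suc n) (\<phi> x ((W ^^ (l * Suc n)) (ket (u (l * n), []))))"
        \<comment> \<open>Here the power of \<open>W\<close> acts before \<open>\<phi> x\<close>, so
          the vanishing must survive an arbitrary element of the tensor algebra.\<close>
        by (rule vanishes_below_tensor_alg[OF phi_tensor_alg W_pow_ell2[OF kets] W_pow_vanishes_below[OF kets]])
      then show "q n ((M ^^ Suc n) x) \<le> 0 * norm x"
        unfolding Mn q_def phi_right_mult by (simp add: vanishes_below_def len l_def)
    qed
  qed
  then obtain n K where K: "\<And>x. q n ((M ^^ n) x) \<le> K * norm x"
    by blast
  have "cmod (\<phi> x (ket (v, [])) (w, es)) \<le> K / cmod (C (l * n)) * norm x" for x
    using K[of x] C[of "l * n"] ext[OF phi_tensor_alg]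
    by (simp add: q_def Mn phi_right_mult norm_mult field_simps)
  then show ?thesis
    unfolding bounded_coeff_def by blast
qed

end

section \<open>From bounded coefficients to a bounded homomorphism\<close>

context tensor_epimorphism
begin

lemma bounded_coeff_zero: "bounded_coeff (\<lambda>_. 0) w"
  by (auto simp: bounded_coeff_def bounded_op_zero[OF bounded_op_phi] intro: exI[of _ 0])

text \<open>Elements of the tensor algebra commute with right translations. The image of \<xi>_{we}
  therefore has nonzero coefficients only at paths ending in e, where they equal those of the image
  of \<xi>_w with e removed. Iterating reduces every path to a vertex.\<close>

lemma bounded_coeff_ket_path:
  assumes vertex: "\<And>v w. v \<in> V \<Longrightarrow> bounded_coeff (ket (v, [])) w"
    and "(u, us) \<in> paths"
  shows "bounded_coeff (ket (u, us)) w"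
  using assms(2)
proof (induction us arbitrary: w rule: rev_induct)
  case Nil
  then show ?case
    by (simp add: path_Nil vertex)
next
  case (snoc e us w)
  note IH = snoc.IH[OF path_snocD[OF snoc.prems]]
  obtain v es where w: "w = (v, es)"
    by (cases w)
  let ?k = "ket (u, us @ [e])"
  have k: "?k \<in> ell2 paths"
    using snoc.prems by (rule ell2_ket)
  have van: "vanishes_below 1 ?k"
    by (auto simp: vanishes_below_def ket_def)
  show ?case
  proof (cases es rule: rev_cases)
    case Nil
    have "\<phi> x ?k w = 0" for x
      using vanishes_below_tensor_alg[OF phi_tensor_alg k van] by (simp add: vanishes_below_def w Nil)
    then show ?thesis
      by (auto simp: bounded_coeff_def intro: exI[of _ 0])
  next
    case (snoc es' e')
    have *: "\<phi> x ?k w = \<phi> x (strip e' ?k) (v, es')" for x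
      using strip_tensor_alg[OF phi_tensor_alg k van, of e' x] by (metis w snoc strip_apply)
    have "strip e' ?k w = (if e' = e then ket (u, us) w else 0)" for w
      by (cases w) (auto simp: strip_apply ket_def)
    then have "strip e' ?k = (if e' = e then ket (u, us) else (\<lambda>_. 0))"
      by auto
    then have "bounded_coeff (strip e' ?k) (v, es')"
      using bounded_coeff_zero IH by simp
    then show ?thesis
      by (simp add: bounded_coeff_def *)
  qed
qed

text \<open>Finite restrictions of \<open>f\<close> are combinations of basis vectors, with bounds
  depending on the finite set. Uniform boundedness removes this dependence, and the restrictions
  approximate \<open>f\<close>.\<close>

lemma bounded_coeff_ell2:
  assumes kets: "\<And>u w. u \<in> paths \<Longrightarrow> bounded_coeff (ket u) w" and f: "f \<in> ell2 paths"
  shows "bounded_coeff f w"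
proof -
  define R where "R F = (\<lambda>w. if w \<in> F then f w else 0)" for F
  have R: "R F \<in> ell2 paths" for F
    unfolding R_def by (rule ell2_restrict[OF f])
  have "\<exists>K. \<forall>x. cmod (\<phi> x (R F) w) \<le> K * norm x" if "finite F" for F
    using that
  proof (induction rule: finite_induct)
    case empty
    then show ?case
      using bounded_coeff_zero by (simp add: R_def bounded_coeff_def)
  next
    case (insert u F)
    then obtain K where K: "\<And>x. cmod (\<phi> x (R F) w) \<le> K * norm x"
      by blast
    show ?case
    proof (cases "u \<in> paths")
      case False
      then have "R (insert u F) = R F"
        using ell2_eq_0[OF f False] by (auto simp: R_def)
      then show ?thesis
        using K by metis
    next
      case True
      then obtain K' where K': "\<And>x. cmod (\<phi> x (ket u) w) \<le> K' * norm x"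
        using kets[of u w] by (auto simp: bounded_coeff_def)
      have "R (insert u F) = (\<lambda>w. R F w + f u * ket u w)"
        using insert.hyps by (auto simp: R_def ket_def)
      then have "\<phi> x (R (insert u F)) w = \<phi> x (R F) w + f u * \<phi> x (ket u) w" for x
        using bounded_op_add[OF bounded_op_phi R ell2_scale[OF ell2_ket[OF True]], of x F "f u"]
          bounded_op_scale[OF bounded_op_phi ell2_ket[OF True], of x "f u"] by simp
      moreover have "cmod (\<phi> x (R F) w + f u * \<phi> x (ket u) w) \<le> (K + cmod (f u) * K') * norm x" for x
      proof -
        have "cmod (\<phi> x (R F) w + f u * \<phi> x (ket u) w) \<le> cmod (\<phi> x (R F) w) + cmod (f u) * cmod (\<phi> x (ket u) w)"
          by (metis norm_mult norm_triangle_ineq)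
        also have "\<dots> \<le> K * norm x + cmod (f u) * (K' * norm x)"
          by (intro add_mono mult_left_mono K K') auto
        finally show ?thesis
          by (simp add: algebra_simps)
      qed
      ultimately show ?thesis
        by metis
    qed
  qed
  then have "\<exists>K. \<forall>F\<in>{F. finite F}. \<forall>x. cmod (\<phi> x (R F) w) \<le> K * norm x"
  proof (intro uniform_boundedness seminorm_coeff)
    show "\<exists>C. \<forall>F\<in>{F. finite F}. cmod (\<phi> x (R F) w) \<le> C" for x
    proof (intro exI ballI)
      fix F
      have "cmod (\<phi> x (R F) w) \<le> opnorm paths (\<phi> x) * l2norm (R F)"
        by (rule norm_bounded_op_le[OF bounded_op_phi R])
      also have "\<dots> \<le> \<bar>opnorm paths (\<phi> x)\<bar> * l2norm f"
        unfolding R_def by (intro mult_mono l2norm_restrict[OF f] l2norm_nonneg) auto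
      finally show "cmod (\<phi> x (R F) w) \<le> \<bar>opnorm paths (\<phi> x)\<bar> * l2norm f" .
    qed
  qed auto
  then obtain K where K: "\<And>F x. finite F \<Longrightarrow> cmod (\<phi> x (R F) w) \<le> K * norm x"
    by auto
  have "cmod (\<phi> x f w) \<le> K * norm x" for x
  proof (rule field_le_epsilon)
    fix d :: real assume d: "d > 0"
    let ?N = "\<bar>opnorm paths (\<phi> x)\<bar> + 1"
    obtain F where F: "finite F" "l2norm (\<lambda>w. if w \<in> F then 0 else f w) \<le> d / ?N"
      using ell2_finite_approx[OF f, of "d / ?N"] d by auto
    have eq: "(\<lambda>w. if w \<in> F then 0 else f w) = (\<lambda>w. f w - R F w)"
      by (auto simp: R_def)
    have "cmod (\<phi> x (\<lambda>w. f w - R F w) w) \<le> opnorm paths (\<phi> x) * l2norm (\<lambda>w. f w - R F w)"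
      by (rule norm_bounded_op_le[OF bounded_op_phi ell2_diff[OF f R]])
    also have "\<dots> \<le> ?N * (d / ?N)"
      using F(2) unfolding eq by (intro mult_mono l2norm_nonneg) auto
    also have "\<dots> = d"
      by simp
    finally have "cmod (\<phi> x f w - \<phi> x (R F) w) \<le> d"
      by (simp add: bounded_op_diff[OF bounded_op_phi f R])
    then show "cmod (\<phi> x f w) \<le> K * norm x + d"
      using K[OF F(1), of x] norm_triangle_ineq2[of "\<phi> x f w" "\<phi> x (R F) w"] by linarith
  qed
  then show ?thesis
    unfolding bounded_coeff_def by blast
qed

text \<open>The operator norm is the supremum of finite partial l2 norms over the unit ball. Each is
  a bounded seminorm in \<open>x\<close>, involving finitely many coefficients, and for fixed
  \<open>x\<close> all are at most \<open>\<bar>opnorm paths (\<phi> x)\<bar>\<close>, so uniform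
  boundedness applies to the pairs \<open>(f, F)\<close>.\<close>

lemma opnorm_phi_bounded:
  assumes coeff: "\<And>f w. f \<in> ell2 paths \<Longrightarrow> bounded_coeff f w"
  shows "\<exists>K. \<forall>x. opnorm paths (\<phi> x) \<le> K * norm x"
proof -
  define I :: "(('v \<times> 'e list \<Rightarrow> complex) \<times> ('v \<times> 'e list) set) set"
    where "I = {(f, F). f \<in> ell2 paths \<and> l2norm f \<le> 1 \<and> finite F}"
  define q where "q = (\<lambda>(f, F) x. L2_set (\<lambda>w. cmod (\<phi> x f w)) F)"
  have "\<exists>K. \<forall>i\<in>I. \<forall>x. q i x \<le> K * norm x"
  proof (rule uniform_boundedness)
    fix i assume "i \<in> I"
    then obtain f F where i: "i = (f, F)" "f \<in> ell2 paths" "l2norm f \<le> 1" "finite F"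
      by (auto simp: I_def)
    show "seminorm (q i)"
      unfolding seminorm_def
    proof (intro conjI allI)
      fix x y
      have "q i (x + y) \<le> L2_set (\<lambda>w. cmod (\<phi> x f w) + cmod (\<phi> y f w)) F"
        unfolding i q_def
        by (auto intro!: L2_set_mono norm_triangle_ineq simp: phi_add op_add_def)
      also have "\<dots> \<le> q i x + q i y"
        unfolding i q_def by (simp add: L2_set_triangle_ineq)
      finally show "q i (x + y) \<le> q i x + q i y" .
    next
      fix c x
      show "q i (c *\<^sub>R x) = \<bar>c\<bar> * q i x"
        unfolding i q_def
        by (simp add: phi_scaleR op_scale_def norm_mult L2_set_right_distrib)
    qed
    obtain K where K: "\<And>w x. cmod (\<phi> x f w) \<le> K w * norm x"
      using coeff[OF i(2)] unfolding bounded_coeff_def by metis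
    have "q i x \<le> (\<Sum>w\<in>F. K w) * norm x" for x
    proof -
      have "q i x \<le> (\<Sum>w\<in>F. cmod (\<phi> x f w))"
        unfolding i q_def by (simp add: L2_set_le_sum)
      also have "\<dots> \<le> (\<Sum>w\<in>F. K w * norm x)"
        by (intro sum_mono K)
      finally show ?thesis
        by (simp add: sum_distrib_right)
    qed
    then show "\<exists>K. \<forall>x. q i x \<le> K * norm x"
      by blast
  next
    fix x
    have "q i x \<le> \<bar>opnorm paths (\<phi> x)\<bar> * 1" if iI: "i \<in> I" for i
    proof -
      obtain f F where i: "i = (f, F)" "f \<in> ell2 paths" "l2norm f \<le> 1"
        using iI by (auto simp: I_def)
      have "q i x \<le> l2norm (\<phi> x f)"
        unfolding i q_def using L2_set_le_l2norm[OF bounded_op_ell2[OF bounded_op_phi i(2)]] by simp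
      also have "\<dots> \<le> opnorm paths (\<phi> x) * l2norm f"
        by (rule opnorm_bound[OF bounded_op_phi i(2)])
      also have "\<dots> \<le> \<bar>opnorm paths (\<phi> x)\<bar> * 1"
        by (intro mult_mono i(3) l2norm_nonneg) auto
      finally show ?thesis .
    qed
    then show "\<exists>C. \<forall>i\<in>I. q i x \<le> C"
      by blast
  qed
  then obtain K where K: "\<And>i x. i \<in> I \<Longrightarrow> q i x \<le> K * norm x"
    by blast
  have "opnorm paths (\<phi> x) \<le> K * norm x" for x
  proof (rule opnorm_le)
    fix f assume f: "f \<in> ell2 paths" "l2norm f \<le> 1"
    show "l2norm (\<phi> x f) \<le> K * norm x"
    proof (rule l2norm_le)
      show "\<phi> x f w = 0" if "w \<notin> paths" for w
        using ell2_eq_0[OF bounded_op_ell2[OF bounded_op_phi f(1)] that] .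
      show "L2_set (\<lambda>w. cmod (\<phi> x f w)) F \<le> K * norm x" if "finite F" for F
        using K[of "(f, F)" x] f that by (simp add: I_def q_def)
    qed
  qed
  then show ?thesis
    by blast
qed

end

theorem theorem2p11:
  fixes V :: "'v set" and E :: "'e set" and r s :: "'e \<Rightarrow> 'v"
    and smul :: "complex \<Rightarrow> 'a::{banach, real_normed_algebra} \<Rightarrow> 'a"
    and \<phi> :: "'a \<Rightarrow> ('v \<times> 'e list) op"
  assumes "digraph V E r s" and "countable V" and "countable E"
    and "no_sinks V E s \<or> no_sources V E r"
    and "complex_banach_algebra smul"
    and "op_alg_hom smul \<phi>"
    and "range \<phi> = tensor_alg V E r s"
  shows "\<forall>x. \<forall>\<epsilon>>0. \<exists>\<delta>>0. \<forall>y. norm (y - x) < \<delta> \<longrightarrow>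
           opnorm (fs_paths V E r s) (op_diff (\<phi> y) (\<phi> x)) < \<epsilon>"
proof -
  interpret tensor_epimorphism V E r s smul \<phi>
    using assms by unfold_locales
  obtain a t where "norm a \<le> 1" "\<And>e. e \<in> E \<Longrightarrow> t e > 0" "\<phi> a = weighted_shift t"
    using weighted_shift_in_range by blast
  then interpret shift_preimage V E r s smul \<phi> a t
    by unfold_locales
  have coeff: "bounded_coeff f w" if f: "f \<in> ell2 paths" for f w
    using assms(4)
  proof
    assume ns: "no_sinks V E s"
    show ?thesis
    proof (cases "w \<in> paths")
      case True
      then show ?thesis
        using bounded_coeff_no_sinks[OF ns f] by (cases w) auto
    next
      case False
      then have "\<phi> x f w = 0" for x
        using ell2_eq_0[OF bounded_op_ell2[OF bounded_op_phi f]] by blast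
      then show ?thesis
        by (auto simp: bounded_coeff_def intro: exI[of _ 0])
    qed
  next
    assume ns: "no_sources V E r"
    have vertex: "bounded_coeff (ket (v, [])) w" if "v \<in> V" for v w
      using bounded_coeff_vertex[OF ns that] by (cases w) simp
    have "bounded_coeff (ket u) w" if "u \<in> paths" for u w
      using bounded_coeff_ket_path[OF vertex] that by (cases u) simp
    then show ?thesis
      using f by (rule bounded_coeff_ell2)
  qed
  then obtain K where K: "\<And>x. opnorm paths (\<phi> x) \<le> K * norm x"
    using opnorm_phi_bounded by blast
  \<comment> \<open>Additivity reduces continuity at \<open>x\<close> to the bound on the operator
    norm.\<close>
  have diff: "op_diff (\<phi> y) (\<phi> x) = \<phi> (y - x)" for x y
    using phi_add[of "y - x" x] by (simp add: op_diff_def op_add_def)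
  show ?thesis
  proof (intro allI impI)
    fix x and \<epsilon> :: real assume eps: "\<epsilon> > 0"
    have "opnorm paths (op_diff (\<phi> y) (\<phi> x)) < \<epsilon>" if "norm (y - x) < \<epsilon> / (\<bar>K\<bar> + 1)" for y
    proof -
      have "opnorm paths (op_diff (\<phi> y) (\<phi> x)) \<le> K * norm (y - x)"
        unfolding diff by (rule K)
      also have "\<dots> \<le> (\<bar>K\<bar> + 1) * norm (y - x)"
        by (intro mult_right_mono) auto
      also have "\<dots> < \<epsilon>"
        using that by (simp add: field_simps)
      finally show ?thesis .
    qed
    then show "\<exists>\<delta>>0. \<forall>y. norm (y - x) < \<delta> \<longrightarrow> opnorm paths (op_diff (\<phi> y) (\<phi> x)) < \<epsilon>"
      using eps by (intro exI[of _ "\<epsilon> / (\<bar>K\<bar> + 1)"]) (auto intro: divide_pos_pos)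
  qed
qed

end
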